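(* Let $D$ be a strongly connected balanced bipartite digraph of order $2a\geq 6$ with partite sets $X$ and $Y$. If $d(x)+d(y)\geq 3a$ for every pair of distinct vertices $\{x,y\}$ either both in $X$ or both in $Y$, then $D$ contains cycles of all even lengths less than or equal to $2a$ (that is, of every length $2,4,\ldots,2a$).
   Context: Digraphs are finite, without loops and without multiple arcs (a pair of opposite arcs $xy$ and $yx$ is allowed and forms a cycle of length 2). The order of a digraph is its number of vertices. A digraph is bipartite with partite sets $X$ and $Y$ if its vertex set is the disjoint union of $X$ and $Y$ and every arc has its end-vertices in different partite sets; it is balanced if $|X|=|Y|$ (so order $2a$ means $|X|=|Y|=a$). The degree of a vertex $x$ is $d(x)=d^+(x)+d^-(x)$, the sum of its out-degree and in-degree. A cycle of length $m\ge 2$ is a directed cycle $x_1x_2\cdots x_mx_1$ on $m$ distinct vertices with arcs $x_ix_{i+1}$ for $1\le i\le m-1$ and $x_mx_1$. A digraph is strongly connected if for every pair of distinct vertices $x,y$ there is a directed path from $x$ to $y$ and one from $y$ to $x$. *)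

theory Defs
  imports "Graph_Theory.Graph_Theory"
begin

definition bipartite_digraph :: "('a, 'b) pre_digraph \<Rightarrow> 'a set \<Rightarrow> 'a set \<Rightarrow> bool" where
  "bipartite_digraph G X Y \<longleftrightarrow>
     verts G = X \<union> Y \<and> X \<inter> Y = {} \<and>
     (\<forall>e \<in> arcs G. (tail G e \<in> X \<and> head G e \<in> Y) \<or> (tail G e \<in> Y \<and> head G e \<in> X))"

definition balanced_bipartite_digraph :: "('a, 'b) pre_digraph \<Rightarrow> 'a set \<Rightarrow> 'a set \<Rightarrow> bool" where
  "balanced_bipartite_digraph G X Y \<longleftrightarrow> bipartite_digraph G X Y \<and> card X = card Y"

definition degree :: "('a, 'b) pre_digraph \<Rightarrow> 'a \<Rightarrow> nat" where
  "degree G x = out_degree G x + in_degree G x"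

text \<open>
  A walk is represented by its list of arcs, so the length of that list is the number of arcs
  of a cycle, and hence also the number of its vertices.
\<close>
definition has_cycle_of_length :: "('a, 'b) pre_digraph \<Rightarrow> nat \<Rightarrow> bool" where
  "has_cycle_of_length G m \<longleftrightarrow> (\<exists>p. pre_digraph.cycle G p \<and> length p = m)"

end

theory Submission
  imports Defs "HOL-Combinatorics.Transposition"
begin

text \<open>
  Write \<open>d\<close> for the degree, and call a vertex low if its degree is below \<open>3a/2\<close>. The hypothesis says
  that each partite set has at most one low vertex, and that a low vertex forces all others on its
  side to have correspondingly larger degree. The proof produces a Hamiltonian cycle and then a
  cycle of length strictly between \<open>a\<close> and \<open>2a\<close>, from which all other lengths are reached.

  Hamiltonicity. Hall's theorem (\<open>hall_marriage\<close>) yields a permutation \<open>\<pi>\<close> of the vertices with an arc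
  from every \<open>v\<close> to \<open>\<pi> v\<close>, that is, a cycle factor. Among all ways to cover the vertices by a cycle \<open>O\<close>
  and a permutation \<open>\<pi>\<close> of the remaining set \<open>R\<close> take one with \<open>O\<close> longest. If \<open>u \<in> O\<close> has the
  successor \<open>u'\<close> on \<open>O\<close>, then for no \<open>w \<in> R\<close> can both arcs from \<open>u\<close> to \<open>\<pi> w\<close> and from \<open>w\<close> to \<open>u'\<close> exist, since
  they would join \<open>O\<close> and the \<open>\<pi>\<close>-orbit of \<open>w\<close> to one longer cycle. Hence at most half of the
  possible arcs between \<open>O\<close> and \<open>R\<close> are present (\<open>longest_spanned_cross\<close>). Compared with the degree
  sums, this leaves only the case that \<open>O\<close> and \<open>R\<close> both span complete bipartite digraphs and \<open>R\<close> is
  not larger than \<open>O\<close>. There the cycle and the permutation can be rerouted at will, so that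
  an arc leaving \<open>O\<close> and an arc entering \<open>O\<close>, which exist by strong connectivity, must lie
  on such sides that a whole side of \<open>R\<close> has no arc to or from \<open>O\<close>; its vertices then have too small
  degrees (\<open>longest_spanned_complete_parts\<close>).

  A long cycle that is not Hamiltonian. A chord of a Hamiltonian cycle that skips ahead by
  \<open>3 \<le> d \<le> a\<close> steps closes a cycle of length \<open>2a + 1 - d > a\<close>. At most one of these chords skips
  only low vertices, and the number of arcs is too large for the absence of all the others,
  except when \<open>a = 4\<close>, where equality forces all remaining chords and a cycle of length 6 can
  be written down (\<open>exists_long_cycle_missing_not_low\<close>).

  Shorter lengths. A vertex \<open>x\<close> outside a cycle of length \<open>2m > a\<close> that is not low has more than \<open>m\<close> arcs
  to and from the cycle. Its in- and out-neighbours therefore overlap after every shift along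
  the cycle, and \<open>x\<close> closes cycles of all even lengths up to \<open>2m\<close> (\<open>long_cycle_shorter\<close>).

  Longer lengths. Suppose a cycle of length \<open>2m\<close> with \<open>a < 2m \<le> 2a - 4\<close> is given and no cycle has length
  \<open>2m + 2\<close>. Then no arc outside the cycle can be inserted between two consecutive cycle vertices,
  which bounds the degrees of the end-vertices of that arc; this shows that vertices outside the cycle that are
  not low are pairwise non-adjacent (\<open>outside_not_low_unlinked\<close>). But such a vertex has so many neighbours on
  the cycle that it can replace a cycle vertex which is not low and is adjacent to another
  outside vertex, a contradiction (\<open>longer_cycle\<close>).
\<close>

section \<open>Hall's theorem\<close>

text \<open>
  The induction of Halmos and Vaughan: if some proper nonempty \<open>J\<close> satisfies Hall's condition with
  equality, then \<open>J\<close> and its complement are matched separately; otherwise any single pair may be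
  matched first.
\<close>
theorem hall_marriage:
  fixes A :: "'i \<Rightarrow> 'b set"
  assumes "finite I" "\<And>i. i \<in> I \<Longrightarrow> finite (A i)"
    and "\<And>J. J \<subseteq> I \<Longrightarrow> card J \<le> card (\<Union> (A ` J))"
  shows "\<exists>f. inj_on f I \<and> (\<forall>i\<in>I. f i \<in> A i)"
  using assms
proof (induction "card I" arbitrary: I A rule: less_induct)
  case less
  note fin = less.prems(1) and finA = less.prems(2) and hall = less.prems(3)
  have finU: "finite (\<Union> (A ` K))" if "K \<subseteq> I" for K
    using that fin finA by (auto intro: finite_subset)
  consider "I = {}" | (tight) J where "J \<subset> I" "J \<noteq> {}" "card (\<Union> (A ` J)) \<le> card J"
    | (slack) "I \<noteq> {}" "\<And>J. J \<subset> I \<Longrightarrow> J \<noteq> {} \<Longrightarrow> card J < card (\<Union> (A ` J))"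
    by (meson not_le_imp_less)
  then show ?case
  proof cases
    case 1
    then show ?thesis by simp
  next
    case tight
    define N where "N = \<Union> (A ` J)"
    have JI: "J \<subseteq> I" and finJ: "finite J"
      using tight fin by (auto intro: finite_subset)
    have "card J < card I"
      using tight fin by (simp add: psubset_card_mono)
    then have "\<exists>f. inj_on f J \<and> (\<forall>i\<in>J. f i \<in> A i)"
      by (rule less.hyps) (use finJ JI finA in \<open>auto intro!: hall\<close>)
    then obtain f where f: "inj_on f J" "\<forall>i\<in>J. f i \<in> A i" by blast
    have restr: "card K \<le> card (\<Union> ((\<lambda>i. A i - N) ` K))" if K: "K \<subseteq> I - J" for K
    proof -
      have finK: "finite K" using K fin finite_subset by blast
      have "card K + card J = card (K \<union> J)"
        using K finK finJ by (subst card_Un_disjoint) auto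
      also have "\<dots> \<le> card (\<Union> (A ` (K \<union> J)))"
        by (rule hall) (use K JI in auto)
      also have "\<Union> (A ` (K \<union> J)) = \<Union> ((\<lambda>i. A i - N) ` K) \<union> N"
        by (auto simp: N_def)
      also have "card \<dots> \<le> card (\<Union> ((\<lambda>i. A i - N) ` K)) + card N"
        by (rule card_Un_le)
      finally show ?thesis using tight by (simp add: N_def)
    qed
    have "card (I - J) < card I"
      using tight fin by (intro psubset_card_mono) auto
    then have "\<exists>g. inj_on g (I - J) \<and> (\<forall>i\<in>I - J. g i \<in> A i - N)"
      by (rule less.hyps) (use fin finA restr in auto)
    then obtain g where g: "inj_on g (I - J)" "\<forall>i\<in>I - J. g i \<in> A i - N" by blast
    have "f i \<noteq> g j" if "i \<in> J" "j \<in> I - J" for i j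
      using f(2) g(2) that by (auto simp: N_def)
    then have "inj_on (\<lambda>i. if i \<in> J then f i else g i) I"
      using f(1) g(1) by (intro inj_onI) (auto dest: inj_onD split: if_splits, metis+)
    moreover have "\<forall>i\<in>I. (if i \<in> J then f i else g i) \<in> A i"
      using f g by auto
    ultimately show ?thesis by blast
  next
    case slack
    then obtain i where i: "i \<in> I" by blast
    have "card {i} \<le> card (\<Union> (A ` {i}))"
      by (rule hall) (use i in auto)
    then obtain b where b: "b \<in> A i" by fastforce
    have restr: "card K \<le> card (\<Union> ((\<lambda>j. A j - {b}) ` K))" if K: "K \<subseteq> I - {i}" for K
    proof (cases "K = {}")
      case False
      have "card K < card (\<Union> (A ` K))"
        by (rule slack(2)) (use K i False in auto)
      also have "\<dots> \<le> card (insert b (\<Union> ((\<lambda>j. A j - {b}) ` K)))"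
        by (rule card_mono) (use finU[of K] K in \<open>auto intro: finite_subset\<close>)
      also have "\<dots> \<le> card {b} + card (\<Union> ((\<lambda>j. A j - {b}) ` K))"
        by (subst insert_is_Un, rule card_Un_le)
      finally show ?thesis by simp
    qed simp
    have "card (I - {i}) < card I"
      using i fin by (intro psubset_card_mono) auto
    then have "\<exists>g. inj_on g (I - {i}) \<and> (\<forall>j\<in>I - {i}. g j \<in> A j - {b})"
      by (rule less.hyps) (use fin finA restr in auto)
    then obtain g where g: "inj_on g (I - {i})" "\<forall>j\<in>I - {i}. g j \<in> A j - {b}" by blast
    have "inj_on (g(i := b)) I"
      using g unfolding inj_on_def by auto
    moreover have "\<forall>j\<in>I. (g(i := b)) j \<in> A j"
      using g b by auto
    ultimately show ?thesis by blast
  qed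
qed

section \<open>Cycles as lists and as periodic functions\<close>

text \<open>
  Lists are convenient for assembling cycles from pieces, periodic functions for index
  arithmetic along a cycle. Both descriptions are used side by side.
\<close>
definition cycle_list :: "('a \<Rightarrow> 'a \<Rightarrow> bool) \<Rightarrow> 'a list \<Rightarrow> bool" where
  "cycle_list E xs \<longleftrightarrow> xs \<noteq> [] \<and> distinct xs \<and> successively E xs \<and> E (last xs) (hd xs)"

definition cycle_fun :: "('a \<Rightarrow> 'a \<Rightarrow> bool) \<Rightarrow> nat \<Rightarrow> (nat \<Rightarrow> 'a) \<Rightarrow> bool" where
  "cycle_fun E n c \<longleftrightarrow>
     n > 0 \<and> (\<forall>i j. c i = c j \<longleftrightarrow> i mod n = j mod n) \<and> (\<forall>i. E (c i) (c (Suc i)))"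

lemma cycle_list_imp_fun:
  assumes "cycle_list E xs"
  obtains c where "cycle_fun E (length xs) c" "range c = set xs"
proof -
  let ?n = "length xs"
  let ?c = "\<lambda>i. xs ! (i mod ?n)"
  have n: "?n > 0" and d: "distinct xs"
    using assms by (auto simp: cycle_list_def)
  have "E (?c i) (?c (Suc i))" for i
  proof (cases "Suc (i mod ?n) = ?n")
    case True
    then have "Suc i mod ?n = 0" by (simp add: mod_Suc)
    moreover have "i mod ?n = ?n - 1" using True by simp
    ultimately show ?thesis
      using assms n unfolding cycle_list_def by (auto simp: last_conv_nth hd_conv_nth)
  next
    case False
    then have "Suc i mod ?n = Suc (i mod ?n)" by (simp add: mod_Suc)
    moreover have "Suc (i mod ?n) < ?n" using False n by (simp add: Suc_lessI)
    ultimately show ?thesis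
      using assms by (simp add: cycle_list_def successively_conv_nth)
  qed
  moreover have "?c i = ?c j \<longleftrightarrow> i mod ?n = j mod ?n" for i j
    using n d by (simp add: nth_eq_iff_index_eq)
  ultimately have "cycle_fun E ?n ?c"
    using n by (simp add: cycle_fun_def)
  moreover have "range ?c = set xs"
  proof
    show "range ?c \<subseteq> set xs" using n by auto
    show "set xs \<subseteq> range ?c"
    proof
      fix x assume "x \<in> set xs"
      then obtain i where "i < ?n" "xs ! i = x" by (metis in_set_conv_nth)
      then have "?c i = x" by simp
      then show "x \<in> range ?c" by blast
    qed
  qed
  ultimately show ?thesis using that by blast
qed

context
  fixes E :: "'a \<Rightarrow> 'a \<Rightarrow> bool" and n :: nat and c :: "nat \<Rightarrow> 'a"
  assumes c: "cycle_fun E n c"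
begin

lemma cycle_fun_pos: "n > 0"
  and cycle_fun_eq_iff: "c i = c j \<longleftrightarrow> i mod n = j mod n"
  and cycle_fun_step: "E (c i) (c (Suc i))"
  using c by (auto simp: cycle_fun_def)

lemma cycle_fun_add_period [simp]: "c (i + n) = c i"
  by (simp add: cycle_fun_eq_iff)

lemma cycle_fun_inj_on_window: "k \<le> n \<Longrightarrow> inj_on c {i..<i + k}"
proof (rule inj_onI)
  fix p q assume *: "k \<le> n" "p \<in> {i..<i + k}" "q \<in> {i..<i + k}" "c p = c q"
  have eq: "p = q" if "p \<le> q" "p mod n = q mod n" "q < p + n" for p q :: nat
  proof -
    have "n dvd q - p" using that mod_eq_dvd_iff_nat[of p q n] by simp
    moreover have "q - p < n" using that by linarith
    ultimately show ?thesis using that by (auto dest: dvd_imp_le)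
  qed
  have "p mod n = q mod n" using * by (simp add: cycle_fun_eq_iff)
  moreover have "q < p + n" "p < q + n" using * by auto
  ultimately show "p = q"
    using eq[of p q] eq[of q p] by (metis nat_le_linear)
qed

lemma cycle_fun_image_window: "c ` {i..<i + n} = range c"
proof
  show "range c \<subseteq> c ` {i..<i + n}"
  proof
    fix x assume "x \<in> range c"
    then obtain j where x: "x = c j" by blast
    have n: "n > 0" by (rule cycle_fun_pos)
    \<comment> \<open>Shifting \<open>j\<close> by \<open>n * i\<close> keeps the subtraction of \<open>i\<close> from being truncated.\<close>
    define k where "k = i + (j + n * i - i) mod n"
    have "k mod n = (i + (j + n * i - i)) mod n"
      by (simp add: k_def mod_add_right_eq)
    also have "i + (j + n * i - i) = j + n * i"
      using n by (cases n) auto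
    finally have "c k = x" by (simp add: x cycle_fun_eq_iff)
    moreover have "k \<in> {i..<i + n}" using n by (simp add: k_def)
    ultimately show "x \<in> c ` {i..<i + n}" by blast
  qed
qed auto

lemma cycle_fun_finite: "finite (range c)"
  using cycle_fun_image_window[of 0] by (metis finite_imageI finite_atLeastLessThan)

lemma cycle_fun_sum: "(\<Sum>v\<in>range c. f v) = (\<Sum>i<n. f (c (i + k)))"
proof -
  have "(\<Sum>v\<in>range c. f v) = sum f (c ` {k..<k + n})"
    by (simp only: cycle_fun_image_window)
  also have "\<dots> = (\<Sum>i\<in>{k..<k + n}. f (c i))"
    using cycle_fun_inj_on_window[of n k] by (simp add: sum.reindex)
  also have "\<dots> = (\<Sum>i<n. f (c (i + k)))"
    by (rule sum.reindex_bij_witness[of _ "\<lambda>i. i + k" "\<lambda>i. i - k"]) auto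
  finally show ?thesis .
qed

lemma cycle_fun_card: "card (range c) = n"
  using cycle_fun_sum[of "\<lambda>_. 1::nat" 0] by simp

lemma cycle_fun_segment:
  assumes "k \<le> n"
  shows "distinct (map c [i..<i + k])" "successively E (map c [i..<i + k])"
  using cycle_fun_inj_on_window[OF assms, of i]
  by (auto simp: distinct_map successively_conv_nth cycle_fun_step)

lemma cycle_fun_close:
  assumes "0 < k" "k \<le> n" "E (c (i + k - 1)) (c i)"
  shows "cycle_list E (map c [i..<i + k])"
  using assms cycle_fun_segment[of k i]
  by (simp add: cycle_list_def last_map hd_map)

text \<open>
  All surgery on a given cycle below, namely inserting, exchanging or attaching vertices, consists
  in closing a segment of the cycle by an outside path.
\<close>
lemma cycle_fun_splice:
  assumes k: "0 < k" "k \<le> n"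
    and ys: "ys \<noteq> []" "distinct ys" "successively E ys" "set ys \<inter> range c = {}"
    and E: "E (c (i + k - 1)) (hd ys)" "E (last ys) (c i)"
  shows "cycle_list E (map c [i..<i + k] @ ys)"
proof -
  have "distinct (map c [i..<i + k] @ ys)"
    using cycle_fun_segment(1)[OF k(2), of i] ys by auto
  moreover have "successively E (map c [i..<i + k] @ ys)"
    using cycle_fun_segment(2)[OF k(2), of i] ys E k
    by (simp add: successively_append_iff last_map)
  ultimately show ?thesis
    using ys E k by (simp add: cycle_list_def hd_append hd_map)
qed

lemma cycle_fun_rotate:
  obtains ys where "cycle_list E ys" "length ys = n" "set ys = range c" "last ys = c i" "hd ys = c (Suc i)"
proof -
  let ?ys = "map c [Suc i..<Suc i + n]"
  have "last ?ys = c i" using cycle_fun_pos by (simp add: last_map)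
  moreover have "hd ?ys = c (Suc i)"
    using cycle_fun_pos by (simp add: hd_map del: upt_Suc)
  moreover have "set ?ys = range c"
    using cycle_fun_image_window[of "Suc i"] by (simp del: upt_Suc)
  moreover have "cycle_list E ?ys"
    using cycle_fun_pos cycle_fun_step[of i] by (intro cycle_fun_close) auto
  ultimately show ?thesis using that[of ?ys] by simp
qed

end

lemma cycle_list_append:
  assumes "cycle_list E xs" "cycle_list E ys" "set xs \<inter> set ys = {}"
    and "E (last xs) (hd ys)" "E (last ys) (hd xs)"
  shows "cycle_list E (xs @ ys)"
  using assms by (auto simp: cycle_list_def successively_append_iff)

text \<open>
  The orbit of \<open>w\<close> under a permutation along arcs is a cycle. It is listed starting at \<open>\<pi> w\<close>, so that it ends
  in \<open>w\<close>: this is the form in which it is appended to another cycle.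
\<close>
lemma cycle_list_orbit:
  assumes R: "finite R" "bij_betw \<pi> R R" "\<And>v. v \<in> R \<Longrightarrow> E v (\<pi> v)" and w: "w \<in> R"
  obtains ys where "cycle_list E ys" "set ys \<subseteq> R" "last ys = w" "hd ys = \<pi> w"
    "bij_betw \<pi> (R - set ys) (R - set ys)"
proof -
  let ?o = "\<lambda>i. (\<pi> ^^ i) w"
  have inj: "inj_on \<pi> R" and im: "\<pi> ` R = R"
    using R by (auto simp: bij_betw_def)
  have oR: "?o i \<in> R" for i
    using w im by (induction i) auto
  have cancel: "?o (j - i) = w" if "i \<le> j" "?o i = ?o j" for i j
    using that
  proof (induction i arbitrary: j)
    case (Suc i)
    then obtain j' where j: "j = Suc j'" by (cases j) auto
    have "?o i = ?o j'"
      using Suc.prems oR inj by (simp add: j inj_on_eq_iff)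
    then show ?case using Suc.IH[of j'] Suc.prems by (simp add: j)
  qed simp
  have "\<not> inj ?o"
  proof
    assume "inj ?o"
    then have "infinite (range ?o)" by (simp add: range_inj_infinite)
    moreover have "range ?o \<subseteq> R" using oR by blast
    ultimately show False using R(1) finite_subset by blast
  qed
  then obtain p q where "p < q" "?o p = ?o q"
    unfolding inj_def by (metis linorder_neq_iff)
  then have ex: "\<exists>k. k > 0 \<and> ?o k = w"
    using cancel[of p q] by (intro exI[of _ "q - p"]) auto
  define k where "k = (LEAST k. k > 0 \<and> ?o k = w)"
  have k: "k > 0" "?o k = w"
    using LeastI_ex[OF ex] by (auto simp: k_def)
  have least: "k \<le> j" if "j > 0" "?o j = w" for j
    unfolding k_def by (rule Least_le) (use that in auto)
  let ?ys = "map (\<lambda>i. ?o (Suc i)) [0..<k]"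
  have nd: "?o (Suc i) \<noteq> ?o (Suc j)" if "i < j" "j < k" for i j
    using cancel[of "Suc i" "Suc j"] least[of "j - i"] that by auto
  have "inj_on (\<lambda>i. ?o (Suc i)) {0..<k}"
    using nd by (intro inj_onI) (metis atLeastLessThan_iff nat_neq_iff)
  then have "distinct ?ys" by (simp add: distinct_map)
  moreover have "E (?o i) (?o (Suc i))" for i
    using R(3)[OF oR[of i]] by simp
  then have "successively E ?ys"
    by (simp add: successively_conv_nth del: funpow.simps)
  moreover have last: "last ?ys = w" using k by (cases k) (simp_all add: last_map)
  moreover have hd: "hd ?ys = \<pi> w" using k by (simp add: hd_map)
  ultimately have "cycle_list E ?ys"
    using k R(3)[OF w] by (simp add: cycle_list_def)
  moreover have sub: "set ?ys \<subseteq> R" by (auto simp: oR simp del: funpow.simps)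
  moreover have "\<pi> ` set ?ys \<subseteq> set ?ys"
  proof (intro image_subsetI)
    fix x assume "x \<in> set ?ys"
    then obtain i where i: "i < k" "x = ?o (Suc i)" by auto
    show "\<pi> x \<in> set ?ys"
    proof (cases "Suc i < k")
      case True
      then have "?o (Suc (Suc i)) \<in> set ?ys"
        by (auto simp del: funpow.simps)
      moreover have "\<pi> x = ?o (Suc (Suc i))" using i by simp
      ultimately show ?thesis by (simp only:)
    next
      case False
      then have "x = w" using i k by (metis Suc_lessI)
      then show ?thesis using hd k by (metis hd_in_set length_greater_0_conv length_map length_upt minus_nat.diff_0)
    qed
  qed
  then have "\<pi> ` set ?ys = set ?ys"
    by (intro card_subset_eq) (use sub inj in \<open>auto simp: card_image inj_on_subset simp del: set_map\<close>)
  then have "bij_betw \<pi> (R - set ?ys) (R - set ?ys)"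
    using inj im sub unfolding bij_betw_def
    by (metis Diff_subset inj_on_image_set_diff inj_on_subset)
  ultimately show ?thesis using that[of ?ys] last hd by blast
qed

section \<open>Degrees in balanced bipartite digraphs\<close>

definition links :: "('a \<Rightarrow> 'a \<Rightarrow> bool) \<Rightarrow> 'a \<Rightarrow> 'a \<Rightarrow> nat" where
  "links E u v = of_bool (E u v) + of_bool (E v u)"

definition deg_in :: "('a \<Rightarrow> 'a \<Rightarrow> bool) \<Rightarrow> 'a set \<Rightarrow> 'a \<Rightarrow> nat" where
  "deg_in E S v = (\<Sum>w\<in>S. links E v w)"

lemma links_commute: "links E u v = links E v u"
  by (simp add: links_def)

lemma deg_in_eq: "deg_in E S v = (\<Sum>w\<in>S. of_bool (E v w)) + (\<Sum>w\<in>S. of_bool (E w v))"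
  by (simp add: deg_in_def links_def sum.distrib)

lemma deg_in_Un_disjoint:
  "finite S \<Longrightarrow> finite T \<Longrightarrow> S \<inter> T = {} \<Longrightarrow> deg_in E (S \<union> T) v = deg_in E S v + deg_in E T v"
  unfolding deg_in_def by (rule sum.union_disjoint)

lemma sum_deg_in_swap: "(\<Sum>u\<in>A. deg_in E B u) = (\<Sum>v\<in>B. deg_in E A v)"
  unfolding deg_in_def by (subst sum.swap) (simp add: links_commute)

lemma sum_deg_in_self: "(\<Sum>v\<in>S. deg_in E S v) = 2 * (\<Sum>v\<in>S. \<Sum>w\<in>S. of_bool (E v w))"
proof -
  have "(\<Sum>v\<in>S. \<Sum>w\<in>S. of_bool (E w v) :: nat) = (\<Sum>v\<in>S. \<Sum>w\<in>S. of_bool (E v w))"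
    by (rule sum.swap)
  then show ?thesis
    unfolding deg_in_eq by (simp add: sum.distrib)
qed

text \<open>
  Only one partite set \<open>X\<close> is named; most statements speak of two vertices being on opposite sides,
  so that the symmetry between the partite sets need not be invoked.
  Strong connectivity is used in the form that every proper nonempty set of vertices is left
  by an arc.
\<close>
locale dense_bipartite =
  fixes V X :: "'a set" and E :: "'a \<Rightarrow> 'a \<Rightarrow> bool" and a :: nat
  assumes finite_V: "finite V"
    and X_subset: "X \<subseteq> V"
    and card_X: "card X = a"
    and card_V_minus_X: "card (V - X) = a"
    and a_ge_3: "a \<ge> 3"
    and edgeD: "E u v \<Longrightarrow> u \<in> V \<and> v \<in> V \<and> (u \<in> X) \<noteq> (v \<in> X)"
    and degree_sum: "u \<in> V \<Longrightarrow> v \<in> V \<Longrightarrow> u \<noteq> v \<Longrightarrow> (u \<in> X) = (v \<in> X) \<Longrightarrow>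
      3 * a \<le> deg_in E V u + deg_in E V v"
    and strong: "S \<subseteq> V \<Longrightarrow> S \<noteq> {} \<Longrightarrow> S \<noteq> V \<Longrightarrow> \<exists>u\<in>S. \<exists>v\<in>V - S. E u v"
begin

abbreviation opposite :: "'a \<Rightarrow> 'a \<Rightarrow> bool" where
  "opposite u v \<equiv> (u \<in> X) \<noteq> (v \<in> X)"

abbreviation deg :: "'a \<Rightarrow> nat" where
  "deg v \<equiv> deg_in E V v"

definition balanced :: "nat \<Rightarrow> 'a set \<Rightarrow> bool" where
  "balanced m S \<longleftrightarrow> S \<subseteq> V \<and> card (S \<inter> X) = m \<and> card (S - X) = m"

definition low :: "'a \<Rightarrow> bool" where
  "low v \<longleftrightarrow> 2 * deg v < 3 * a"

definition complete :: "'a set \<Rightarrow> bool" where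
  "complete S \<longleftrightarrow> (\<forall>u\<in>S. \<forall>v\<in>S. opposite u v \<longrightarrow> E u v)"

lemma links_le_opposite: "links E u v \<le> 2 * of_bool (opposite u v)"
  using edgeD by (auto simp: links_def)

lemma links_le_2: "links E u v \<le> 2"
  by (simp add: links_def)

lemma balanced_V: "balanced a V"
  using X_subset card_X card_V_minus_X by (simp add: balanced_def Int_absorb1)

lemma balanced_subset: "balanced m S \<Longrightarrow> S \<subseteq> V"
  by (simp add: balanced_def)

lemma balanced_finite: "balanced m S \<Longrightarrow> finite S"
  using finite_V finite_subset balanced_subset by blast

lemma balanced_card:
  assumes "balanced m S"
  shows "card S = 2 * m"
proof -
  have "card S = card (S \<inter> X) + card (S - X)"
    using balanced_finite[OF assms] by (simp add: card_Int_Diff)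
  then show ?thesis using assms by (simp add: balanced_def)
qed

lemma balanced_Diff:
  assumes "balanced m S"
  shows "balanced (a - m) (V - S)"
proof -
  have fin: "finite (S \<inter> X)" "finite (S - X)"
    using balanced_finite[OF assms] by auto
  have "(V - S) \<inter> X = X - S \<inter> X" "(V - S) - X = (V - X) - (S - X)"
    using X_subset by auto
  moreover have "S \<inter> X \<subseteq> X" "S - X \<subseteq> V - X"
    using balanced_subset[OF assms] by auto
  ultimately show ?thesis
    using assms fin by (simp add: balanced_def card_Diff_subset card_X card_V_minus_X)
qed

lemma balanced_Un:
  assumes "balanced m S" "balanced k T" "S \<inter> T = {}"
  shows "balanced (m + k) (S \<union> T)"
proof -
  have "card (S \<inter> X \<union> T \<inter> X) = m + k" "card ((S - X) \<union> (T - X)) = m + k"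
    using assms balanced_finite[OF assms(1)] balanced_finite[OF assms(2)]
    by (auto simp: balanced_def intro!: card_Un_disjoint[THEN trans])
  moreover have "(S \<union> T) \<inter> X = S \<inter> X \<union> T \<inter> X" "(S \<union> T) - X = (S - X) \<union> (T - X)" by auto
  ultimately show ?thesis
    using assms by (simp add: balanced_def)
qed

lemma balanced_le:
  assumes "balanced m S"
  shows "m \<le> a"
proof -
  have "card (S \<inter> X) \<le> card X"
    using X_subset finite_V by (intro card_mono) (auto intro: finite_subset)
  then show ?thesis using assms card_X by (simp add: balanced_def)
qed

lemma card_side:
  assumes "balanced m S"
  shows "card {w \<in> S. (w \<in> X) = b} = m"
proof -
  have "{w \<in> S. (w \<in> X) = True} = S \<inter> X" "{w \<in> S. (w \<in> X) = False} = S - X" by auto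
  then show ?thesis using assms by (cases b) (simp_all add: balanced_def)
qed

lemma sum_opposite:
  assumes "balanced m S"
  shows "(\<Sum>w\<in>S. of_bool (opposite u w)) = m" "(\<Sum>w\<in>S. of_bool ((u \<in> X) = (w \<in> X))) = m"
proof -
  have "(\<Sum>w\<in>S. of_bool ((w \<in> X) = b)) = card {w \<in> S. (w \<in> X) = b}" for b
    using balanced_finite[OF assms] by (simp add: Int_def)
  from this[of "u \<in> X"] this[of "u \<notin> X"]
  show "(\<Sum>w\<in>S. of_bool (opposite u w)) = m" "(\<Sum>w\<in>S. of_bool ((u \<in> X) = (w \<in> X))) = m"
    using card_side[OF assms] by (simp_all add: eq_commute)
qed

lemma deg_in_le:
  assumes "balanced m S"
  shows "deg_in E S u \<le> 2 * m"
proof -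
  have "deg_in E S u \<le> (\<Sum>w\<in>S. 2 * of_bool (opposite u w))"
    unfolding deg_in_def by (rule sum_mono) (rule links_le_opposite)
  also have "\<dots> = 2 * (\<Sum>w\<in>S. of_bool (opposite u w))"
    by (rule sum_distrib_left[symmetric])
  finally show ?thesis using sum_opposite(1)[OF assms, of u] by (simp del: sum_of_bool_eq)
qed

lemma sum_deg_in_self_le:
  assumes "balanced m S"
  shows "(\<Sum>u\<in>S. deg_in E S u) \<le> 4 * m * m"
proof -
  have "(\<Sum>u\<in>S. deg_in E S u) \<le> (\<Sum>u\<in>S. 2 * m)"
    by (rule sum_mono) (rule deg_in_le[OF assms])
  then show ?thesis by (simp add: balanced_card[OF assms])
qed

text \<open>
  The value \<open>4 * m * m\<close> is the maximum allowed by \<open>sum_deg_in_self_le\<close>.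
\<close>
lemma completeI:
  assumes S: "balanced m S" and full: "(\<Sum>u\<in>S. deg_in E S u) \<ge> 4 * m * m"
  shows "complete S"
  unfolding complete_def
proof (intro ballI impI)
  fix u v assume u: "u \<in> S" and v: "v \<in> S" and opp: "opposite u v"
  note fin = balanced_finite[OF S]
  show "E u v"
  proof (rule ccontr)
    assume "\<not> E u v"
    then have "links E u v < 2 * of_bool (opposite u v)"
      using opp by (simp add: links_def)
    then have "deg_in E S u < (\<Sum>w\<in>S. 2 * of_bool (opposite u w))"
      unfolding deg_in_def using v fin links_le_opposite
      by (intro sum_strict_mono_ex1 ballI bexI[of _ v])
    also have "\<dots> = 2 * (\<Sum>w\<in>S. of_bool (opposite u w))"
      by (rule sum_distrib_left[symmetric])
    also have "\<dots> = 2 * m" by (simp only: sum_opposite(1)[OF S])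
    finally have "(\<Sum>u\<in>S. deg_in E S u) < (\<Sum>u\<in>S. 2 * m)"
      using u fin deg_in_le[OF S] by (intro sum_strict_mono_ex1) auto
    then show False using full by (simp add: balanced_card[OF S])
  qed
qed

lemma deg_split:
  assumes "S \<subseteq> V"
  shows "deg v = deg_in E S v + deg_in E (V - S) v"
  using deg_in_Un_disjoint[of S "V - S" E v] assms finite_V
  by (auto simp: Un_absorb1 finite_subset)

lemma exists_other_same_side:
  assumes "u \<in> V"
  obtains v where "v \<in> V" "v \<noteq> u" "(v \<in> X) = (u \<in> X)"
proof -
  have "card {w \<in> V. (w \<in> X) = (u \<in> X)} > card {u}"
    using card_side[OF balanced_V] a_ge_3 by simp
  then have "\<not> {w \<in> V. (w \<in> X) = (u \<in> X)} \<subseteq> {u}"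
    using card_mono[of "{u}"] by (metis finite.emptyI finite.insertI not_le)
  then show ?thesis using that by blast
qed

lemma deg_ge:
  assumes "u \<in> V"
  shows "a \<le> deg u"
proof -
  obtain v where "v \<in> V" "v \<noteq> u" "(v \<in> X) = (u \<in> X)"
    using exists_other_same_side[OF assms] .
  then have "3 * a \<le> deg u + deg v" "deg v \<le> 2 * a"
    using degree_sum[of u v] assms deg_in_le[OF balanced_V] by auto
  then show ?thesis by simp
qed

lemma low_unique:
  "low u \<Longrightarrow> low v \<Longrightarrow> u \<in> V \<Longrightarrow> v \<in> V \<Longrightarrow> (u \<in> X) = (v \<in> X) \<Longrightarrow> u = v"
  using degree_sum[of u v] by (force simp: low_def)

text \<open>
  On average the degrees in \<open>T\<close> are at least \<open>3a/2\<close>: a low vertex, of which there is at most one, is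
  compensated by pairing it with any other vertex.
\<close>
lemma sum_degrees_side:
  assumes T: "T \<subseteq> V" "card T \<ge> 2" and side: "\<And>v. v \<in> T \<Longrightarrow> (v \<in> X) = b"
  shows "3 * a * card T \<le> 2 * (\<Sum>v\<in>T. deg v)"
proof -
  have fin: "finite T" using T finite_V finite_subset by blast
  have nonlow: "3 * a * card U \<le> (\<Sum>v\<in>U. 2 * deg v)" if "\<And>v. v \<in> U \<Longrightarrow> \<not> low v" for U
    using sum_mono[of U "\<lambda>_. 3 * a" "\<lambda>v. 2 * deg v"] that by (simp add: low_def not_less mult.commute)
  show ?thesis
  proof (cases "\<exists>u\<in>T. low u")
    case False
    then show ?thesis using nonlow[of T] by (simp add: sum_distrib_left)
  next
    case True
    then obtain u where u: "u \<in> T" "low u" by blast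
    have "\<not> T \<subseteq> {u}" using T(2) card_mono[of "{u}" T] by auto
    then obtain v where v: "v \<in> T" "v \<noteq> u" by blast
    have T_eq: "T = insert u (insert v (T - {u, v}))" using u v by blast
    have nl: "\<not> low w" if "w \<in> T - {u, v}" for w
      using low_unique[of u w] u that T side by blast
    have uv: "3 * a \<le> deg u + deg v"
      using degree_sum[of u v] u v T side by blast
    have "(\<Sum>w\<in>T. 2 * deg w) = 2 * deg u + 2 * deg v + (\<Sum>w\<in>T - {u, v}. 2 * deg w)"
      by (subst T_eq) (use fin v in simp)
    moreover have "card T = 2 + card (T - {u, v})"
      by (subst T_eq) (use fin v in simp)
    moreover have "3 * a * card (T - {u, v}) \<le> (\<Sum>w\<in>T - {u, v}. 2 * deg w)"
      by (rule nonlow) (rule nl)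
    ultimately have "3 * a * card T \<le> (\<Sum>w\<in>T. 2 * deg w)"
      using uv by (simp add: algebra_simps)
    then show ?thesis by (simp add: sum_distrib_left)
  qed
qed

lemma sum_degrees_balanced:
  assumes S: "balanced m S" and m: "m \<ge> 2"
  shows "3 * a * m \<le> (\<Sum>v\<in>S. deg v)"
proof -
  have "3 * a * m \<le> 2 * (\<Sum>v\<in>S \<inter> X. deg v)"
    using sum_degrees_side[of "S \<inter> X" True] S m by (auto simp: balanced_def)
  moreover have "3 * a * m \<le> 2 * (\<Sum>v\<in>S - X. deg v)"
    using sum_degrees_side[of "S - X" False] S m by (auto simp: balanced_def)
  moreover have "(\<Sum>v\<in>S. deg v) = (\<Sum>v\<in>S \<inter> X. deg v) + (\<Sum>v\<in>S - X. deg v)"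
    using balanced_finite[OF S] by (simp add: sum.Int_Diff)
  ultimately show ?thesis by simp
qed

context
  fixes n :: nat and c :: "nat \<Rightarrow> 'a"
  assumes c: "cycle_fun E n c"
begin

lemma cycle_fun_in_V: "c i \<in> V"
  using cycle_fun_step[OF c, of i] edgeD by blast

lemma cycle_fun_opposite: "(c (i + d) \<in> X) = ((c i \<in> X) = even d)"
proof (induction d)
  case (Suc d)
  then show ?case using cycle_fun_step[OF c, of "i + d"] edgeD by auto
qed simp

lemma cycle_fun_balanced: "even n" "balanced (n div 2) (range c)"
proof -
  show ev: "even n"
    using cycle_fun_opposite[of 0 n] cycle_fun_add_period[OF c, of 0] by auto
  have fin: "finite (range c)" by (rule cycle_fun_finite[OF c])
  have "card (range c \<inter> X) = (\<Sum>v\<in>range c. of_bool (v \<in> X))"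
    using fin by (simp add: Int_def)
  also have "\<dots> = (\<Sum>i<n. of_bool (c (i + 1) \<in> X))"
    by (rule cycle_fun_sum[OF c])
  also have "\<dots> = (\<Sum>i<n. of_bool (c (i + 0) \<notin> X))"
    by (rule sum.cong) (use cycle_fun_opposite[of _ 1] in auto)
  also have "\<dots> = (\<Sum>v\<in>range c. of_bool (v \<notin> X))"
    by (rule cycle_fun_sum[OF c, symmetric])
  also have "\<dots> = card (range c - X)"
    using fin by (simp add: Int_def set_diff_eq)
  finally have "card (range c \<inter> X) = card (range c - X)" .
  moreover have "card (range c) = card (range c \<inter> X) + card (range c - X)"
    using fin by (simp add: card_Int_Diff)
  ultimately show "balanced (n div 2) (range c)"
    using cycle_fun_card[OF c] cycle_fun_in_V by (auto simp: balanced_def)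
qed

end

section \<open>Existence of a cycle factor\<close>

lemma deg_deficit:
  assumes M: "M \<subseteq> V" "\<And>w. w \<in> M \<Longrightarrow> opposite u w \<and> links E u w \<le> 1"
  shows "deg u + card M \<le> 2 * a"
proof -
  have "card M = (\<Sum>w\<in>V. of_bool (w \<in> M))"
    using M(1) finite_V by (simp add: Int_absorb1)
  then have "deg u + card M = (\<Sum>w\<in>V. links E u w + of_bool (w \<in> M))"
    by (simp add: deg_in_def sum.distrib)
  also have "\<dots> \<le> (\<Sum>w\<in>V. 2 * of_bool (opposite u w))"
  proof (rule sum_mono)
    fix w assume "w \<in> V"
    show "links E u w + of_bool (w \<in> M) \<le> 2 * of_bool (opposite u w)"
      using M(2)[of w] links_le_opposite[of u w] by (cases "w \<in> M") auto
  qed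
  also have "\<dots> = 2 * (\<Sum>w\<in>V. of_bool (opposite u w))"
    by (rule sum_distrib_left[symmetric])
  finally show ?thesis by (simp only: sum_opposite(1)[OF balanced_V])
qed

lemma half_bound:
  assumes "S \<subseteq> V" "card S \<ge> 2" and side: "\<And>s. s \<in> S \<Longrightarrow> (s \<in> X) = b"
    and M: "M \<subseteq> V" "\<And>s w. s \<in> S \<Longrightarrow> w \<in> M \<Longrightarrow> opposite s w \<and> links E s w \<le> 1"
  shows "2 * card M \<le> a"
proof -
  have "finite S" using assms(1) finite_V finite_subset by blast
  then obtain s t where st: "s \<in> S" "t \<in> S" "s \<noteq> t"
    using assms(2) card_le_Suc0_iff_eq[of S] by fastforce
  then have "3 * a \<le> deg s + deg t"
    using degree_sum[of s t] assms(1) side by blast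
  moreover have "deg s + card M \<le> 2 * a" "deg t + card M \<le> 2 * a"
    using deg_deficit[OF M(1)] M(2) st by blast+
  ultimately show ?thesis by simp
qed

text \<open>
  If Hall's condition fails for \<open>S\<close>, then there is a set \<open>T\<close> on the other side with no arcs from \<open>S\<close> to
  \<open>T\<close> and \<open>|S| + |T| > a\<close>. Strong connectivity excludes that \<open>S\<close> or \<open>T\<close> is a single vertex; with two
  vertices in each, the degree condition gives \<open>2|S| \<le> a\<close> and \<open>2|T| \<le> a\<close>.
\<close>
lemma hall_one_side:
  assumes S: "S \<subseteq> V" and side: "\<And>s. s \<in> S \<Longrightarrow> (s \<in> X) = b"
  shows "card S \<le> card (\<Union>s\<in>S. {w. E s w})"
proof (rule ccontr)
  assume less: "\<not> ?thesis"
  define N where "N = (\<Union>s\<in>S. {w. E s w})"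
  define Y where "Y = {w \<in> V. (w \<in> X) = (\<not> b)}"
  define T where "T = Y - N"
  have finS: "finite S" and finY: "finite Y"
    using S finite_V finite_subset by (auto simp: Y_def)
  have cY: "card Y = a" unfolding Y_def by (rule card_side[OF balanced_V])
  have NY: "N \<subseteq> Y" using side edgeD unfolding N_def Y_def by blast
  have cT: "card T + card N = a"
    using NY finY cY card_mono[OF finY NY] unfolding T_def
    by (simp add: card_Diff_subset finite_subset)
  have lt: "card N < card S" using less by (simp add: N_def)
  have noarc: "\<not> E s t" if "s \<in> S" "t \<in> T" for s t
    using that by (auto simp: T_def N_def)
  have opp: "opposite s t" if "s \<in> S" "t \<in> T" for s t
    using that side by (auto simp: T_def Y_def)
  have cS_le: "card S \<le> a"
    using card_mono[of "{w \<in> V. (w \<in> X) = b}" S] S side finite_V card_side[OF balanced_V, of b]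
    by auto
  have "card S \<noteq> 1"
  proof
    assume 1: "card S = 1"
    then obtain s where s: "S = {s}" by (rule card_1_singletonE)
    have "N = {}" using lt 1 NY finY finite_subset by fastforce
    moreover have "V \<noteq> {s}" using balanced_card[OF balanced_V] a_ge_3 by auto
    ultimately show False using strong[OF S] s by (auto simp: N_def)
  qed
  then have S2: "card S \<ge> 2" using lt by linarith
  have "card T \<noteq> 1"
  proof
    assume 1: "card T = 1"
    then obtain t where t: "T = {t}" by (rule card_1_singletonE)
    have "card S = a" using 1 cT lt cS_le by simp
    then have "S = {w \<in> V. (w \<in> X) = b}"
      using S side finite_V card_side[OF balanced_V, of b] by (intro card_subset_eq) auto
    moreover have "t \<in> V" "(t \<in> X) = (\<not> b)" using t by (auto simp: T_def Y_def)
    moreover have "V - {t} \<noteq> {}"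
      using balanced_card[OF balanced_V] a_ge_3 card_mono[of "{t}" V] by auto
    ultimately show False
      using strong[of "V - {t}"] noarc t edgeD by blast
  qed
  then have T2: "card T \<ge> 2" using lt cT cS_le by linarith
  have "2 * card T \<le> a"
    by (rule half_bound[of S b]) (use S S2 side noarc opp in \<open>auto simp: T_def Y_def links_def\<close>)
  moreover have "2 * card S \<le> a"
    by (rule half_bound[of T "\<not> b"]) (use S T2 side noarc opp in \<open>auto simp: T_def Y_def links_def\<close>)
  ultimately show False using lt cT by linarith
qed

lemma exists_cycle_factor:
  obtains \<pi> where "bij_betw \<pi> V V" "\<And>v. v \<in> V \<Longrightarrow> E v (\<pi> v)"
proof -
  let ?A = "\<lambda>v. {w. E v w}"
  have finA: "finite (\<Union> (?A ` K))" for K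
    using finite_V by (rule rev_finite_subset) (use edgeD in blast)
  have "card J \<le> card (\<Union> (?A ` J))" if J: "J \<subseteq> V" for J
  proof -
    have finJ: "finite J" using J finite_V finite_subset by blast
    have "card J = card (J \<inter> X) + card (J - X)" using finJ by (simp add: card_Int_Diff)
    also have "\<dots> \<le> card (\<Union> (?A ` (J \<inter> X))) + card (\<Union> (?A ` (J - X)))"
      using hall_one_side[of "J \<inter> X" True] hall_one_side[of "J - X" False] J
      by (intro add_mono) auto
    also have "\<dots> = card (\<Union> (?A ` (J \<inter> X)) \<union> \<Union> (?A ` (J - X)))"
      using edgeD by (intro card_Un_disjoint[symmetric] finA) blast
    also have "\<Union> (?A ` (J \<inter> X)) \<union> \<Union> (?A ` (J - X)) = \<Union> (?A ` J)" by blast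
    finally show ?thesis .
  qed
  then obtain \<pi> where \<pi>: "inj_on \<pi> V" "\<forall>v\<in>V. \<pi> v \<in> ?A v"
    using hall_marriage[of V ?A] finite_V finA[of "{v}" for v] by auto
  have "\<pi> ` V \<subseteq> V" using \<pi>(2) edgeD by blast
  then have "bij_betw \<pi> V V"
    using \<pi>(1) finite_V by (simp add: bij_betw_def endo_inj_surj)
  then show ?thesis using that \<pi>(2) by blast
qed

section \<open>Hamiltonicity\<close>

text \<open>
  A cycle factor with one distinguished cycle \<open>xs\<close>; the other cycles are the orbits of \<open>\<pi>\<close> on the
  vertices outside \<open>xs\<close>.
\<close>
definition spanned_by :: "'a list \<Rightarrow> ('a \<Rightarrow> 'a) \<Rightarrow> bool" where
  "spanned_by xs \<pi> \<longleftrightarrow> cycle_list E xs \<and> bij_betw \<pi> (V - set xs) (V - set xs) \<and>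
     (\<forall>v\<in>V - set xs. E v (\<pi> v))"

definition longest_spanned :: "'a list \<Rightarrow> ('a \<Rightarrow> 'a) \<Rightarrow> bool" where
  "longest_spanned xs \<pi> \<longleftrightarrow> spanned_by xs \<pi> \<and> (\<forall>ys \<sigma>. spanned_by ys \<sigma> \<longrightarrow> length ys \<le> length xs)"

lemma cycle_list_balanced:
  assumes "cycle_list E xs"
  shows "even (length xs)" "balanced (length xs div 2) (set xs)"
proof -
  obtain c where c: "cycle_fun E (length xs) c" "range c = set xs"
    using assms by (rule cycle_list_imp_fun)
  show "even (length xs)" "balanced (length xs div 2) (set xs)"
    using cycle_fun_balanced[OF c(1)] c(2) by auto
qed

lemma exists_longest_spanned: "\<exists>xs \<pi>. longest_spanned xs \<pi>"
proof -
  obtain \<pi> where \<pi>: "bij_betw \<pi> V V" "\<And>v. v \<in> V \<Longrightarrow> E v (\<pi> v)"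
    using exists_cycle_factor by blast
  obtain w where "w \<in> V"
    using balanced_card[OF balanced_V] a_ge_3 by fastforce
  then obtain ys where "cycle_list E ys" "set ys \<subseteq> V" "bij_betw \<pi> (V - set ys) (V - set ys)"
    using cycle_list_orbit[of V \<pi> E w] finite_V \<pi> by metis
  then have "spanned_by ys \<pi>" using \<pi>(2) by (simp add: spanned_by_def)
  moreover have "length xs \<le> card V" if "spanned_by xs \<sigma>" for xs \<sigma>
    using that cycle_list_balanced(2)[of xs] finite_V
    by (auto simp: spanned_by_def cycle_list_def balanced_def distinct_card[symmetric] intro: card_mono)
  ultimately show ?thesis
    using ex_has_greatest_nat[of "\<lambda>(xs, \<sigma>). spanned_by xs \<sigma>" "(ys, \<pi>)" "\<lambda>(xs, \<sigma>). length xs" "Suc (card V)"]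
    unfolding longest_spanned_def by (fastforce simp: less_Suc_eq_le)
qed

text \<open>
  The cycle \<open>ys\<close> is allowed to differ from \<open>xs\<close>, so that the lemma applies to every rotation of \<open>xs\<close> and to
  every rerouting of it through the same vertices.
\<close>
lemma longest_spanned_no_merge:
  assumes max: "longest_spanned xs \<pi>"
    and ys: "spanned_by ys \<sigma>" "length ys = length xs"
    and w: "w \<in> V - set ys"
  shows "\<not> (E (last ys) (\<sigma> w) \<and> E w (hd ys))"
proof
  assume E: "E (last ys) (\<sigma> w) \<and> E w (hd ys)"
  have \<sigma>: "bij_betw \<sigma> (V - set ys) (V - set ys)" "\<And>v. v \<in> V - set ys \<Longrightarrow> E v (\<sigma> v)"
    using ys by (auto simp: spanned_by_def)
  obtain zs where zs: "cycle_list E zs" "set zs \<subseteq> V - set ys" "last zs = w" "hd zs = \<sigma> w"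
    "bij_betw \<sigma> (V - set ys - set zs) (V - set ys - set zs)"
    using cycle_list_orbit[of "V - set ys" \<sigma> E w] finite_V \<sigma> w by blast
  have "cycle_list E (ys @ zs)"
    using ys zs E by (intro cycle_list_append) (auto simp: spanned_by_def)
  moreover have "V - set (ys @ zs) = V - set ys - set zs" by auto
  ultimately have "spanned_by (ys @ zs) \<sigma>"
    using zs \<sigma>(2) by (simp add: spanned_by_def)
  then have "length (ys @ zs) \<le> length xs"
    using max unfolding longest_spanned_def by blast
  then show False using zs(1) ys(2) by (simp add: cycle_list_def)
qed

text \<open>
  The arc from \<open>u\<close> to \<open>\<pi> w\<close> and the arc from \<open>w\<close> to the successor of \<open>u\<close> exclude each other. As \<open>\<pi>\<close> and the
  successor map are bijections, every arc between the cycle and its complement occurs in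
  exactly one such pair, and there are \<open>2 * m * (a - m)\<close> pairs \<open>(u, w)\<close> on a common side.
\<close>
lemma longest_spanned_cross:
  assumes max: "longest_spanned xs \<pi>" and len: "length xs = 2 * m"
  shows "(\<Sum>u\<in>set xs. deg_in E (V - set xs) u) \<le> 2 * m * (a - m)"
proof -
  define R where "R = V - set xs"
  have xs: "cycle_list E xs" and \<pi>: "bij_betw \<pi> R R" "\<And>v. v \<in> R \<Longrightarrow> E v (\<pi> v)"
    using max by (auto simp: longest_spanned_def spanned_by_def R_def)
  obtain c where c: "cycle_fun E (2 * m) c" and cx: "range c = set xs"
    using cycle_list_imp_fun[OF xs] len by metis
  have R: "balanced (a - m) R"
    using balanced_Diff[OF cycle_list_balanced(2)[OF xs]] len by (simp add: R_def)
  have no: "\<not> (E (c i) (\<pi> w) \<and> E w (c (Suc i)))" if w: "w \<in> R" for i w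
  proof -
    obtain ys where "cycle_list E ys" "length ys = 2 * m" "set ys = range c" "last ys = c i" "hd ys = c (Suc i)"
      using cycle_fun_rotate[OF c] .
    then show ?thesis
      using longest_spanned_no_merge[OF max, of ys \<pi> w] \<pi> w cx len
      by (auto simp: spanned_by_def R_def)
  qed
  have "(\<Sum>u\<in>set xs. deg_in E R u) =
      (\<Sum>u\<in>range c. \<Sum>w\<in>R. of_bool (E u w) :: nat) + (\<Sum>u\<in>range c. \<Sum>w\<in>R. of_bool (E w u) :: nat)"
    unfolding deg_in_eq cx by (rule sum.distrib)
  also have "(\<Sum>u\<in>range c. \<Sum>w\<in>R. of_bool (E u w) :: nat) = (\<Sum>u\<in>range c. \<Sum>w\<in>R. of_bool (E u (\<pi> w)) :: nat)"
    by (intro sum.cong refl sum.reindex_bij_betw[OF \<pi>(1), symmetric])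
  also have "\<dots> = (\<Sum>i<2 * m. \<Sum>w\<in>R. of_bool (E (c (i + 0)) (\<pi> w)) :: nat)"
    by (rule cycle_fun_sum[OF c])
  also have "(\<Sum>u\<in>range c. \<Sum>w\<in>R. of_bool (E w u) :: nat) = (\<Sum>i<2 * m. \<Sum>w\<in>R. of_bool (E w (c (i + 1))) :: nat)"
    by (rule cycle_fun_sum[OF c])
  also have "(\<Sum>i<2 * m. \<Sum>w\<in>R. of_bool (E (c (i + 0)) (\<pi> w)) :: nat) + \<dots> =
      (\<Sum>i<2 * m. \<Sum>w\<in>R. of_bool (E (c i) (\<pi> w)) + of_bool (E w (c (Suc i))) :: nat)"
    by (simp only: sum.distrib add_0_right Suc_eq_plus1)
  also have "\<dots> \<le> (\<Sum>i<2 * m. \<Sum>w\<in>R. of_bool ((c i \<in> X) = (w \<in> X)))"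
  proof (intro sum_mono)
    fix i w assume w: "w \<in> R"
    show "of_bool (E (c i) (\<pi> w)) + of_bool (E w (c (Suc i))) \<le> (of_bool ((c i \<in> X) = (w \<in> X)) :: nat)"
      using no[OF w, of i] edgeD[of "c i" "\<pi> w"] edgeD[OF \<pi>(2)[OF w]] edgeD[of w "c (Suc i)"]
        cycle_fun_opposite[OF c, of i 1] by auto
  qed
  also have "\<dots> = (\<Sum>i<2 * m. a - m)"
    by (simp only: sum_opposite(2)[OF R])
  finally show ?thesis by (simp add: R_def)
qed

lemma complete_links:
  "complete S \<Longrightarrow> u \<in> S \<Longrightarrow> v \<in> S \<Longrightarrow> opposite u v \<Longrightarrow> E u v"
  by (auto simp: complete_def)

lemma transpose_side:
  "(p \<in> X) = (q \<in> X) \<Longrightarrow> (transpose p q v \<in> X) = (v \<in> X)"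
  by (auto simp: transpose_def)

text \<open>
  Exchanging two vertices on the same side is an automorphism of a complete bipartite digraph,
  so it maps a spanning cycle to another one; a suitable exchange makes \<open>u'\<close> the successor of \<open>u\<close>.
\<close>
lemma complete_cycle_through:
  assumes xs: "cycle_list E xs" and comp: "complete (set xs)"
    and u: "u \<in> set xs" and u': "u' \<in> set xs" and opp: "opposite u u'"
  obtains ys where "cycle_list E ys" "set ys = set xs" "length ys = length xs" "last ys = u" "hd ys = u'"
proof -
  obtain c where c: "cycle_fun E (length xs) c" and cx: "range c = set xs"
    using cycle_list_imp_fun[OF xs] .
  obtain i where i: "c i = u" using u by (metis cx rangeE)
  obtain ys where ys: "cycle_list E ys" "length ys = length xs" "set ys = set xs" "last ys = u" "hd ys = c (Suc i)"
    using cycle_fun_rotate[OF c, of i] cx i by metis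
  define p where "p = c (Suc i)"
  define \<tau> where "\<tau> = transpose p u'"
  have side: "(p \<in> X) = (u' \<in> X)"
    using cycle_fun_opposite[OF c, of i 1] i opp by (auto simp: p_def)
  have p: "p \<in> set xs" using cx by (auto simp: p_def)
  have \<tau>X: "(\<tau> v \<in> X) = (v \<in> X)" for v
    unfolding \<tau>_def by (rule transpose_side[OF side])
  have \<tau>S: "\<tau> ` set xs = set xs"
    unfolding \<tau>_def using p u' by (simp add: transpose_image_eq)
  have step: "E (\<tau> v) (\<tau> w)" if "E v w" "v \<in> set xs" "w \<in> set xs" for v w
    using complete_links[OF comp, of "\<tau> v" "\<tau> w"] that \<tau>S \<tau>X edgeD[OF that(1)] by blast
  have ne: "ys \<noteq> []" using ys(1) by (simp add: cycle_list_def)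
  have "cycle_list E (map \<tau> ys)"
    unfolding cycle_list_def
  proof (intro conjI)
    show "distinct (map \<tau> ys)"
      using ys(1) by (simp add: cycle_list_def distinct_map \<tau>_def)
    show "successively E (map \<tau> ys)"
      unfolding successively_map
      by (rule successively_mono[of E]) (use ys(1,3) step in \<open>auto simp: cycle_list_def\<close>)
    show "E (last (map \<tau> ys)) (hd (map \<tau> ys))"
      using step[of u p] cycle_fun_step[OF c, of i] i u p ys(4,5) ne
      by (simp add: last_map hd_map p_def)
  qed (use ne in simp)
  moreover have "last (map \<tau> ys) = u"
    using ne ys(4) opp side by (auto simp: last_map \<tau>_def transpose_def)
  moreover have "hd (map \<tau> ys) = u'"
    using ne ys(5) by (simp add: hd_map \<tau>_def p_def)
  ultimately show ?thesis using that[of "map \<tau> ys"] ys \<tau>S by simp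
qed

lemma complete_factor_through:
  assumes \<pi>: "bij_betw \<pi> R R" "\<And>v. v \<in> R \<Longrightarrow> E v (\<pi> v)" and comp: "complete R"
    and w: "w \<in> R" and v: "v \<in> R" and opp: "opposite w v"
  obtains \<sigma> where "bij_betw \<sigma> R R" "\<forall>v\<in>R. E v (\<sigma> v)" "\<sigma> w = v"
proof -
  define \<tau> where "\<tau> = transpose (\<pi> w) v"
  have side: "(\<pi> w \<in> X) = (v \<in> X)"
    using edgeD[OF \<pi>(2)[OF w]] opp by blast
  have \<pi>w: "\<pi> w \<in> R" using \<pi>(1) w by (meson bij_betw_apply)
  have \<tau>: "bij_betw \<tau> R R"
    unfolding \<tau>_def bij_betw_def using \<pi>w v by (simp add: transpose_image_eq)
  have \<tau>X: "(\<tau> z \<in> X) = (z \<in> X)" for z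
    unfolding \<tau>_def by (rule transpose_side[OF side])
  have bij: "bij_betw (\<tau> \<circ> \<pi>) R R"
    using \<pi>(1) \<tau> by (rule bij_betw_trans)
  moreover have "E z ((\<tau> \<circ> \<pi>) z)" if "z \<in> R" for z
  proof (rule complete_links[OF comp that])
    show "(\<tau> \<circ> \<pi>) z \<in> R" using bij that by (rule bij_betw_apply)
    show "opposite z ((\<tau> \<circ> \<pi>) z)" using edgeD[OF \<pi>(2)[OF that]] \<tau>X by simp
  qed
  moreover have "(\<tau> \<circ> \<pi>) w = v" by (simp add: \<tau>_def)
  ultimately show ?thesis using that by blast
qed

text \<open>
  Since both parts are complete, the cycle and the permutation can be chosen to contain any
  prescribed arc. So an arc leaving the cycle and an arc entering it cannot start on the
  same side, and by strong connectivity exactly one side has leaving arcs and the other one has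
  entering arcs. Then the vertices outside the cycle on the side where the leaving arcs start have no arc to
  or from the cycle, and their degrees are too small.
\<close>
lemma longest_spanned_complete_parts:
  assumes max: "longest_spanned xs \<pi>" and len: "length xs = 2 * m"
    and O: "complete (set xs)" and R: "complete (V - set xs)" "m < a" "2 * (a - m) \<le> a"
  shows False
proof -
  let ?O = "set xs" and ?R = "V - set xs"
  have xs: "cycle_list E xs" and \<pi>: "bij_betw \<pi> ?R ?R" "\<And>v. v \<in> ?R \<Longrightarrow> E v (\<pi> v)"
    using max by (auto simp: longest_spanned_def spanned_by_def)
  have balO: "balanced m ?O" using cycle_list_balanced(2)[OF xs] len by simp
  have balR: "balanced (a - m) ?R" by (rule balanced_Diff[OF balO])
  have no: "\<not> (E u v \<and> E w u')"
    if prems: "u \<in> ?O" "u' \<in> ?O" "v \<in> ?R" "w \<in> ?R" "opposite u u'" "opposite w v"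
    for u u' v w
  proof -
    obtain ys where "cycle_list E ys" "set ys = ?O" "length ys = length xs" "last ys = u" "hd ys = u'"
      by (rule complete_cycle_through[OF xs O prems(1,2,5)])
    moreover obtain \<sigma> where "bij_betw \<sigma> ?R ?R" "\<forall>v\<in>?R. E v (\<sigma> v)" "\<sigma> w = v"
      by (rule complete_factor_through[OF \<pi> R(1) prems(4,3,6)])
    ultimately show ?thesis
      using longest_spanned_no_merge[OF max, of ys \<sigma> w] prems by (auto simp: spanned_by_def)
  qed
  have ne: "?O \<noteq> {}" "?O \<subseteq> V" "?O \<noteq> V"
    using xs balO balanced_card[OF balO] balanced_card[OF balanced_V] R(2)
    by (auto simp: cycle_list_def balanced_def)
  obtain u v where uv: "u \<in> ?O" "v \<in> ?R" "E u v"
    using strong[of ?O] ne by blast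
  obtain w u' where wu: "w \<in> ?R" "u' \<in> ?O" "E w u'"
  proof -
    have R': "?R \<subseteq> V" "?R \<noteq> {}" "?R \<noteq> V" "V - ?R = ?O" using uv ne(2) by auto
    show ?thesis using strong[OF R'(1-3)] that unfolding R'(4) by blast
  qed
  have opp: "opposite u w"
    using no[of u u' v w] uv wu edgeD[OF uv(3)] edgeD[OF wu(3)] by blast
  have iso: "deg_in E ?O z = 0" if z: "z \<in> ?R" "opposite z w" for z
  proof -
    have "\<not> E z y \<and> \<not> E y z" if y: "y \<in> ?O" for y
      using no[of u y v z] no[of y u' z w] uv wu y z opp edgeD[OF uv(3)] edgeD[OF wu(3)]
        edgeD[of z y] edgeD[of y z] by blast
    then show ?thesis by (simp add: deg_in_def links_def)
  qed
  have small: "deg z \<le> 2 * (a - m)" if z: "z \<in> ?R" "opposite z w" for z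
    using deg_split[of ?O z] ne(2) iso[OF z] deg_in_le[OF balR, of z] by simp
  let ?Z = "{z \<in> ?R. (z \<in> X) = (w \<notin> X)}"
  have cZ: "card ?Z = a - m" by (rule card_side[OF balR])
  have finZ: "finite ?Z" using finite_V by simp
  have "?Z \<noteq> {}" using cZ R(2) by (metis card.empty less_irrefl zero_less_diff)
  then obtain z where z: "z \<in> ?R" "opposite z w" by blast
  have "2 * (a - m) \<ge> a" using small[OF z] deg_ge[of z] z by simp
  then have "card ?Z \<ge> 2" using cZ a_ge_3 by linarith
  then obtain y z where yz: "y \<in> ?Z" "z \<in> ?Z" "y \<noteq> z"
    using card_le_Suc0_iff_eq[OF finZ] by fastforce
  then have "3 * a \<le> deg y + deg z"
    by (intro degree_sum) auto
  moreover have "deg y \<le> 2 * (a - m)" "deg z \<le> 2 * (a - m)"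
    using small yz by auto
  ultimately show False using R(3) a_ge_3 by linarith
qed

text \<open>
  If the longest cycle has length 2, then so has every cycle of the factor. By the bound on
  cross arcs, the degrees on each of these cycles sum to at most \<open>2a + 2\<close>; but on two of them
  together they sum to at least \<open>6a\<close>.
\<close>
lemma longest_spanned_not_short:
  assumes max: "longest_spanned xs \<pi>"
  shows "length xs \<noteq> 2"
proof
  assume len: "length xs = 2"
  let ?R = "V - set xs"
  have bound: "(\<Sum>v\<in>set zs. deg v) \<le> 2 * a + 2" if zs: "longest_spanned zs \<sigma>" "length zs = 2" for zs \<sigma>
  proof -
    have bal: "balanced 1 (set zs)"
      using cycle_list_balanced(2)[of zs] zs by (simp add: longest_spanned_def spanned_by_def)
    have "(\<Sum>v\<in>set zs. deg v) = (\<Sum>v\<in>set zs. deg_in E (set zs) v) + (\<Sum>v\<in>set zs. deg_in E (V - set zs) v)"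
      using deg_split[OF balanced_subset[OF bal]] by (simp add: sum.distrib)
    then show ?thesis
      using sum_deg_in_self_le[OF bal] longest_spanned_cross[of zs \<sigma> 1] zs a_ge_3 by simp
  qed
  have xs: "cycle_list E xs" and \<pi>: "bij_betw \<pi> ?R ?R" "\<And>v. v \<in> ?R \<Longrightarrow> E v (\<pi> v)"
    using max by (auto simp: longest_spanned_def spanned_by_def)
  have balO: "balanced 1 (set xs)" using cycle_list_balanced(2)[OF xs] len by simp
  obtain p q where pq: "xs = [p, q]"
    using len by (metis length_0_conv length_Suc_conv numeral_2_eq_2)
  have E: "E p q" "E q p" "p \<noteq> q" using xs by (auto simp: pq cycle_list_def)
  have "card ?R \<noteq> 0"
    using balanced_card[OF balanced_Diff[OF balO]] a_ge_3 by simp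
  then obtain w where w: "w \<in> ?R" by (metis all_not_in_conv card.empty)
  obtain ys where ys: "cycle_list E ys" "set ys \<subseteq> ?R" "bij_betw \<pi> (?R - set ys) (?R - set ys)"
    using cycle_list_orbit[of ?R \<pi> E w] finite_V \<pi> w by (metis finite_Diff)
  \<comment> \<open>The 2-cycle \<open>xs\<close> joins the rest of the factor, and the orbit \<open>ys\<close> takes its place as the
    distinguished cycle.\<close>
  define \<sigma> where "\<sigma> v = (if v = p then q else if v = q then p else \<pi> v)" for v
  have eq: "V - set ys = (?R - set ys) \<union> {p, q}"
    using ys(2) balanced_subset[OF balO] by (auto simp: pq)
  have "bij_betw \<sigma> (?R - set ys) (?R - set ys)"
    using ys(3) by (rule bij_betw_cong[THEN iffD1, rotated]) (auto simp: \<sigma>_def pq)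
  moreover have "bij_betw \<sigma> {p, q} {p, q}"
    using E(3) by (auto simp: bij_betw_def inj_on_def \<sigma>_def)
  ultimately have "bij_betw \<sigma> (V - set ys) (V - set ys)"
    unfolding eq by (rule bij_betw_combine) (auto simp: pq)
  moreover have "E v (\<sigma> v)" if "v \<in> V - set ys" for v
    using \<pi>(2)[of v] E that by (auto simp: \<sigma>_def pq)
  ultimately have sp: "spanned_by ys \<sigma>" using ys by (simp add: spanned_by_def)
  then have "length ys \<le> 2" using max len by (auto simp: longest_spanned_def)
  moreover have "length ys \<noteq> 0" "even (length ys)"
    using ys(1) cycle_list_balanced(1)[OF ys(1)] by (auto simp: cycle_list_def)
  ultimately have len': "length ys = 2" by presburger
  then have max': "longest_spanned ys \<sigma>" using sp max len by (simp add: longest_spanned_def)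
  have balY: "balanced 1 (set ys)" using cycle_list_balanced(2)[OF ys(1)] len' by simp
  have dis: "set xs \<inter> set ys = {}" using ys(2) by blast
  have "balanced 2 (set xs \<union> set ys)"
    using balanced_Un[OF balO balY dis] by (simp add: numeral_2_eq_2)
  then have "3 * a * 2 \<le> (\<Sum>v\<in>set xs \<union> set ys. deg v)"
    by (rule sum_degrees_balanced) simp
  also have "\<dots> = (\<Sum>v\<in>set xs. deg v) + (\<Sum>v\<in>set ys. deg v)"
    using dis by (simp add: sum.union_disjoint)
  finally show False
    using bound[OF max len] bound[OF max' len'] a_ge_3 by linarith
qed

text \<open>
  Let \<open>m\<close> and \<open>r\<close> be the half lengths of the longest distinguished cycle and of its complement. For
  \<open>r \<ge> 2\<close> the degree sums on both parts force \<open>m = r = a/2\<close> with equality everywhere, and for \<open>r = 1\<close> the small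
  degrees of the two remaining vertices force all others to be large. In both cases the parts are
  complete.
\<close>
theorem hamiltonian:
  obtains xs where "cycle_list E xs" "length xs = 2 * a"
proof -
  obtain xs \<pi> where max: "longest_spanned xs \<pi>"
    using exists_longest_spanned by blast
  let ?O = "set xs" and ?R = "V - set xs"
  have xs: "cycle_list E xs" and \<pi>: "bij_betw \<pi> ?R ?R" "\<And>v. v \<in> ?R \<Longrightarrow> E v (\<pi> v)"
    using max by (auto simp: longest_spanned_def spanned_by_def)
  obtain m where len: "length xs = 2 * m"
    using cycle_list_balanced(1)[OF xs] by blast
  have balO: "balanced m ?O" using cycle_list_balanced(2)[OF xs] len by simp
  define r where "r = a - m"
  have balR: "balanced r ?R" unfolding r_def by (rule balanced_Diff[OF balO])
  have m_le: "m \<le> a" by (rule balanced_le[OF balO])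
  have m2: "m \<ge> 2"
  proof -
    have "m \<noteq> 0" using xs len by (cases m) (auto simp: cycle_list_def)
    moreover have "m \<noteq> 1" using longest_spanned_not_short[OF max] len by auto
    ultimately show ?thesis by simp
  qed
  define cross where "cross = (\<Sum>u\<in>?O. deg_in E ?R u)"
  have cross_le: "cross \<le> 2 * m * r"
    unfolding cross_def r_def by (rule longest_spanned_cross[OF max len])
  have sumO: "(\<Sum>v\<in>?O. deg v) = (\<Sum>v\<in>?O. deg_in E ?O v) + cross"
    using deg_split[OF balanced_subset[OF balO]] by (simp add: sum.distrib cross_def)
  have sumR: "(\<Sum>v\<in>?R. deg v) = (\<Sum>v\<in>?R. deg_in E ?R v) + cross"
    using deg_split[OF balanced_subset[OF balO]] sum_deg_in_swap[of E ?R ?O]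
    by (simp add: sum.distrib cross_def)
  have "r = 0"
  proof (rule ccontr)
    assume "r \<noteq> 0"
    then consider (big) "r \<ge> 2" | (one) "r = 1" by linarith
    then have "complete ?O \<and> complete ?R \<and> 2 * r \<le> a"
    proof cases
      case big
      have O: "3 * a * m \<le> (\<Sum>v\<in>?O. deg_in E ?O v) + cross"
        using sum_degrees_balanced[OF balO m2] sumO by simp
      have R: "3 * a * r \<le> (\<Sum>v\<in>?R. deg_in E ?R v) + cross"
        using sum_degrees_balanced[OF balR big] sumR by simp
      have "m * (3 * a) \<le> m * (4 * m + 2 * r)"
        using O sum_deg_in_self_le[OF balO] cross_le by (simp add: algebra_simps)
      then have 1: "3 * a \<le> 4 * m + 2 * r" using m2 by simp
      have "r * (3 * a) \<le> r * (4 * r + 2 * m)"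
        using R sum_deg_in_self_le[OF balR] cross_le by (simp add: algebra_simps)
      then have 2: "3 * a \<le> 4 * r + 2 * m" using big by simp
      have mr: "m = r" "a = 2 * r" using 1 2 m_le r_def by linarith+
      have "complete ?O"
        by (rule completeI[OF balO]) (use O cross_le mr in simp)
      moreover have "complete ?R"
        by (rule completeI[OF balR]) (use R cross_le mr in simp)
      ultimately show ?thesis using mr by simp
    next
      case one
      have m: "m = a - 1" using one r_def by linarith
      obtain x where x: "?R \<inter> X = {x}"
        using balR one by (auto simp: balanced_def card_1_singleton_iff)
      obtain y where y: "?R - X = {y}"
        using balR one by (auto simp: balanced_def card_1_singleton_iff)
      have R: "?R = {x, y}" and xy: "x \<in> X" "y \<notin> X" "x \<in> V" "y \<in> V" "x \<noteq> y" using x y by auto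
      have \<pi>R: "\<pi> z \<in> {x, y}" if "z \<in> {x, y}" for z
        using bij_betw_apply[OF \<pi>(1)] that unfolding R by blast
      have E: "E x y" "E y x"
        using \<pi>(2)[of x] \<pi>(2)[of y] \<pi>R[of x] \<pi>R[of y] edgeD[of x x] edgeD[of y y] R by auto
      have "complete ?R" using E xy by (auto simp: complete_def R)
      moreover have "complete ?O"
      proof (rule completeI[OF balO])
        have "(\<Sum>v\<in>?R. deg_in E ?R v) \<le> 4" using sum_deg_in_self_le[OF balR] one by simp
        then have xy_le: "deg x + deg y \<le> 4 + cross" and cr: "cross \<le> 2 * m"
          using sumR xy cross_le one by (auto simp: R)
        have "4 \<le> (\<Sum>v\<in>?R. deg_in E ?R v)"
          using E xy by (simp add: R deg_in_def links_def)
        then have xy_ge: "deg x + deg y \<ge> 4 + cross" using sumR xy by (simp add: R)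
        \<comment> \<open>Each cycle vertex has degree at least \<open>3a\<close> minus that of the outside vertex on its side.\<close>
        have side: "m * (3 * a) \<le> (\<Sum>v\<in>{v \<in> ?O. (v \<in> X) = (z \<in> X)}. deg v) + m * deg z"
          if z: "z \<in> V" "z \<notin> ?O" for z
        proof -
          have "(\<Sum>v\<in>{v \<in> ?O. (v \<in> X) = (z \<in> X)}. 3 * a) \<le>
              (\<Sum>v\<in>{v \<in> ?O. (v \<in> X) = (z \<in> X)}. deg v + deg z)"
            using degree_sum z balanced_subset[OF balO] by (intro sum_mono) auto
          then show ?thesis using card_side[OF balO, of "z \<in> X"] by (simp add: sum.distrib)
        qed
        have "(\<Sum>v\<in>?O. deg v) = (\<Sum>v\<in>{v \<in> ?O. (v \<in> X) = (x \<in> X)}. deg v) +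
            (\<Sum>v\<in>{v \<in> ?O. (v \<in> X) = (y \<in> X)}. deg v)"
          by (subst sum.union_disjoint[symmetric]) (use xy in \<open>auto intro!: sum.cong\<close>)
        moreover have "x \<notin> ?O" "y \<notin> ?O" using R by auto
        ultimately have "m * (6 * a) \<le> (\<Sum>v\<in>?O. deg v) + m * (deg x + deg y)"
          using side[of x] side[of y] xy by (simp add: algebra_simps)
        moreover have "m * (deg x + deg y) \<le> m * (4 + 2 * m)"
          using xy_le cr by (intro mult_le_mono2) linarith
        ultimately have "m * (6 * a) \<le> (\<Sum>v\<in>?O. deg_in E ?O v) + 2 * m + m * (4 + 2 * m)"
          using sumO cr by linarith
        moreover have "a = m + 1" using m a_ge_3 by simp
        ultimately show "4 * m * m \<le> (\<Sum>v\<in>?O. deg_in E ?O v)"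
          by (simp add: algebra_simps)
      qed
      ultimately show ?thesis using one a_ge_3 by simp
    qed
    moreover have "m < a" using \<open>r \<noteq> 0\<close> r_def by simp
    ultimately show False
      using longest_spanned_complete_parts[OF max len] r_def by blast
  qed
  then have "m = a" using m_le r_def by simp
  then show ?thesis using that xs len by blast
qed

section \<open>From one long cycle to other lengths\<close>

lemma sum_low_le_1:
  assumes "S \<subseteq> V"
  shows "(\<Sum>v\<in>S. of_bool (low v \<and> (v \<in> X) = b)) \<le> (1::nat)"
proof -
  have fin: "finite S" using assms finite_V finite_subset by blast
  have "card {v \<in> S. low v \<and> (v \<in> X) = b} \<le> Suc 0"
    using low_unique assms fin by (subst card_le_Suc0_iff_eq) auto
  then show ?thesis using fin by (simp add: Int_def)
qed

lemma exists_not_low: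
  assumes "T \<subseteq> V" "card T \<ge> 2" "\<And>v. v \<in> T \<Longrightarrow> (v \<in> X) = b"
  obtains v where "v \<in> T" "\<not> low v"
proof -
  have "finite T" using assms finite_V finite_subset by blast
  then obtain u v where "u \<in> T" "v \<in> T" "u \<noteq> v"
    using assms(2) card_le_Suc0_iff_eq[of T] by fastforce
  then show ?thesis using low_unique[of u v] assms that by blast
qed

context
  fixes m :: nat and c :: "nat \<Rightarrow> 'a"
  assumes c: "cycle_fun E (2 * m) c"
begin

lemma even_cycle_balanced: "balanced m (range c)"
  using cycle_fun_balanced(2)[OF c] by simp

lemma even_cycle_complement: "balanced (a - m) (V - range c)"
  by (rule balanced_Diff[OF even_cycle_balanced])

lemma sum_even_cycle: "(\<Sum>v\<in>range c. f v) = (\<Sum>i<2 * m. f (c (i + k)))"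
  by (rule cycle_fun_sum[OF c])

text \<open>
  The out-neighbours of \<open>x\<close> on the cycle and the in-neighbours shifted back by \<open>2 * (k - 1)\<close> steps all lie among
  the \<open>m\<close> cycle vertices opposite to \<open>x\<close>. Together they are more than \<open>m\<close>, so they have a common element.
\<close>
lemma attached_vertex_cycles:
  assumes x: "x \<notin> range c" and many: "deg_in E (range c) x > m" and k: "1 \<le> k" "k \<le> m"
  obtains ys where "cycle_list E ys" "length ys = 2 * k"
proof (rule ccontr)
  assume no: "\<not> thesis"
  define t where "t = 2 * (k - 1)"
  have nope: "\<not> (E x (c i) \<and> E (c (i + t)) x)" for i
  proof
    assume "E x (c i) \<and> E (c (i + t)) x"
    then have "cycle_list E (map c [i..<i + Suc t] @ [x])"
      using x k by (intro cycle_fun_splice[OF c]) (auto simp: t_def)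
    then show False using no that k by (auto simp: t_def)
  qed
  have "deg_in E (range c) x =
      (\<Sum>i<2 * m. of_bool (E x (c (i + 0)))) + (\<Sum>i<2 * m. of_bool (E (c (i + t)) x))"
    unfolding deg_in_eq by (intro arg_cong2[where f = "(+)"] sum_even_cycle)
  also have "\<dots> = (\<Sum>i<2 * m. of_bool (E x (c i)) + of_bool (E (c (i + t)) x))"
    by (simp add: sum.distrib del: sum_of_bool_eq)
  also have "\<dots> \<le> (\<Sum>i<2 * m. of_bool (opposite x (c (i + 0))))"
  proof (rule sum_mono)
    fix i
    have "(c (i + t) \<in> X) = (c i \<in> X)"
      using cycle_fun_opposite[OF c, of i t] by (simp add: t_def)
    then show "of_bool (E x (c i)) + of_bool (E (c (i + t)) x) \<le> (of_bool (opposite x (c (i + 0))) :: nat)"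
      using nope[of i] edgeD[of x "c i"] edgeD[of "c (i + t)" x] by auto
  qed
  also have "\<dots> = (\<Sum>v\<in>range c. of_bool (opposite x v))"
    by (rule sum_even_cycle[symmetric])
  also have "\<dots> = m" by (rule sum_opposite(1)[OF even_cycle_balanced])
  finally show False using many by simp
qed

text \<open>
  At most \<open>2 * (a - m)\<close> of the at least \<open>3a/2\<close> arcs at \<open>x\<close> avoid the cycle, and \<open>a < 2 * m\<close> makes the remaining
  number exceed \<open>m\<close>.
\<close>
lemma long_cycle_shorter:
  assumes long: "a < 2 * m" and x: "x \<in> V - range c" "\<not> low x" and k: "1 \<le> k" "k \<le> m"
  obtains ys where "cycle_list E ys" "length ys = 2 * k"
proof (rule attached_vertex_cycles[OF _ _ k])
  show "x \<notin> range c" using x by blast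
  have "deg x = deg_in E (range c) x + deg_in E (V - range c) x"
    by (rule deg_split[OF balanced_subset[OF even_cycle_balanced]])
  then show "m < deg_in E (range c) x"
    using deg_in_le[OF even_cycle_complement, of x] x(2) long balanced_le[OF even_cycle_balanced]
    by (simp add: low_def)
qed (rule that)

context
  assumes no_longer: "\<forall>ys. cycle_list E ys \<longrightarrow> length ys \<noteq> 2 * m + 2"
begin

text \<open>
  If \<open>v\<close> has an arc to \<open>x\<close>, then \<open>y\<close> has no arc to the successor of \<open>v\<close>: otherwise \<open>x\<close> and \<open>y\<close> could be inserted between
  the two.
\<close>
lemma no_pair_insertion:
  assumes xy: "x \<in> V - range c" "y \<in> V - range c" "E x y"
  shows "(\<Sum>v\<in>range c. of_bool (E v x)) + (\<Sum>v\<in>range c. of_bool (E y v)) \<le> m"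
proof -
  have ne: "x \<noteq> y" using edgeD[OF xy(3)] by blast
  have m: "0 < 2 * m" by (rule cycle_fun_pos[OF c])
  have nope: "\<not> (E (c i) x \<and> E y (c (Suc i)))" for i
  proof
    assume "E (c i) x \<and> E y (c (Suc i))"
    then have "cycle_list E (map c [Suc i..<Suc i + 2 * m] @ [x, y])"
      using xy ne m by (intro cycle_fun_splice[OF c]) (auto simp: cycle_fun_add_period[OF c])
    from no_longer[rule_format, OF this] show False by (simp del: upt_Suc)
  qed
  have "(\<Sum>v\<in>range c. of_bool (E v x)) + (\<Sum>v\<in>range c. of_bool (E y v)) =
      (\<Sum>i<2 * m. of_bool (E (c (i + 0)) x)) + ((\<Sum>i<2 * m. of_bool (E y (c (i + 1)))) :: nat)"
    by (intro arg_cong2[where f = "(+)"] sum_even_cycle)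
  also have "\<dots> = (\<Sum>i<2 * m. of_bool (E (c i) x) + of_bool (E y (c (Suc i))))"
    by (simp add: sum.distrib del: sum_of_bool_eq)
  also have "\<dots> \<le> (\<Sum>i<2 * m. of_bool (opposite x (c (i + 0))))"
  proof (rule sum_mono)
    fix i
    show "of_bool (E (c i) x) + of_bool (E y (c (Suc i))) \<le> (of_bool (opposite x (c (i + 0))) :: nat)"
      using nope[of i] edgeD[of "c i" x] edgeD[of y "c (Suc i)"] edgeD[OF xy(3)]
        cycle_fun_opposite[OF c, of i 1] by auto
  qed
  also have "\<dots> = (\<Sum>v\<in>range c. of_bool (opposite x v))"
    by (rule sum_even_cycle[symmetric])
  also have "\<dots> = m" by (rule sum_opposite(1)[OF even_cycle_balanced])
  finally show ?thesis .
qed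

lemma pair_degree_bound:
  assumes xy: "x \<in> V - range c" "y \<in> V - range c"
  shows "deg_in E (range c) x + deg_in E (range c) y + m * links E x y \<le> 4 * m"
proof -
  let ?out = "\<lambda>v. \<Sum>w\<in>range c. of_bool (E v w) :: nat" and ?in = "\<lambda>v. \<Sum>w\<in>range c. of_bool (E w v) :: nat"
  have le: "?out v \<le> m \<and> ?in v \<le> m" for v
  proof -
    have "?out v \<le> (\<Sum>w\<in>range c. of_bool (opposite v w))" "?in v \<le> (\<Sum>w\<in>range c. of_bool (opposite v w))"
      using edgeD by (auto intro!: sum_mono simp del: sum_of_bool_eq)
    then show ?thesis by (simp only: sum_opposite(1)[OF even_cycle_balanced])
  qed
  have "?in x + ?out y + m * of_bool (E x y) \<le> 2 * m"
    using no_pair_insertion[OF xy] le[of x] le[of y] by (cases "E x y") simp_all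
  moreover have "?in y + ?out x + m * of_bool (E y x) \<le> 2 * m"
    using no_pair_insertion[OF xy(2,1)] le[of x] le[of y] by (cases "E y x") simp_all
  ultimately show ?thesis
    unfolding deg_in_eq links_def by (simp add: algebra_simps del: sum_of_bool_eq)
qed

context
  assumes long: "a < 2 * m" and room: "m + 2 \<le> a"
begin

lemma outside_not_low_links_le_1:
  assumes "x \<in> V - range c" "y \<in> V - range c" "\<not> low x" "\<not> low y"
  shows "links E x y \<le> 1"
proof (rule ccontr)
  assume "\<not> ?thesis"
  then have "links E x y = 2" using links_le_2[of x y] by linarith
  then have "deg_in E (range c) x + deg_in E (range c) y \<le> 2 * m"
    using pair_degree_bound[OF assms(1,2)] by simp
  then show False
    using deg_split[OF balanced_subset[OF even_cycle_balanced], of x] assms(3,4) long room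
      deg_split[OF balanced_subset[OF even_cycle_balanced], of y]
      deg_in_le[OF even_cycle_complement, of x] deg_in_le[OF even_cycle_complement, of y]
    unfolding low_def by linarith
qed

text \<open>
  There is at most one low vertex opposite to \<open>x\<close>; so if \<open>x\<close> has at most \<open>p\<close> arcs in common with any opposite outside
  vertex, and at most \<open>q\<close> more with a low one, the excess \<open>q\<close> is counted only once.
\<close>
lemma outside_deg_le:
  assumes x: "x \<in> V - range c"
    and links: "\<And>y. y \<in> V - range c \<Longrightarrow> links E x y \<le> p * of_bool (opposite x y) + q * of_bool (low y \<and> opposite x y)"
  shows "deg_in E (V - range c) x \<le> p * (a - m) + q"
proof -
  let ?R = "V - range c"
  have "deg_in E ?R x \<le> (\<Sum>y\<in>?R. p * of_bool (opposite x y) + q * of_bool (low y \<and> opposite x y))"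
    unfolding deg_in_def using links by (rule sum_mono)
  also have "\<dots> = p * (\<Sum>y\<in>?R. of_bool (opposite x y)) + q * (\<Sum>y\<in>?R. of_bool (low y \<and> opposite x y))"
    by (simp add: sum.distrib sum_distrib_left del: sum_of_bool_eq)
  also have "(\<Sum>y\<in>?R. of_bool (opposite x y)) = a - m"
    by (rule sum_opposite(1)[OF even_cycle_complement])
  also have "q * (\<Sum>y\<in>?R. of_bool (low y \<and> opposite x y)) \<le> q * 1"
    using sum_low_le_1[of ?R "x \<notin> X"] by (intro mult_le_mono2) (auto simp del: sum_of_bool_eq simp: eq_commute)
  finally show ?thesis by simp
qed

lemma outside_not_low_deg_le:
  assumes "x \<in> V - range c" "\<not> low x"
  shows "deg_in E (V - range c) x \<le> (a - m) + 1"
proof -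
  have "links E x y \<le> 1 * of_bool (opposite x y) + 1 * of_bool (low y \<and> opposite x y)"
    if "y \<in> V - range c" for y
    using outside_not_low_links_le_1[OF assms(1) that assms(2)] links_le_opposite[of x y]
    by (cases "low y") (auto simp: of_bool_def split: if_splits)
  from outside_deg_le[OF assms(1) this] show ?thesis by simp
qed

text \<open>
  Suppose that \<open>x\<close> is joined to \<open>z\<close> by a 2-cycle. Then \<open>z\<close> is low. Adding the bounds for the pairs \<open>x, y\<close> and
  \<open>x, z\<close>, where the lowness of \<open>z\<close> is compensated by \<open>y\<close>, gives \<open>6a \<le> 5a + 3\<close>.
\<close>
lemma outside_linked_links_le_1:
  assumes x: "x \<in> V - range c" "\<not> low x" and y: "y \<in> V - range c" "\<not> low y"
    and linked: "links E x y \<noteq> 0" and z: "z \<in> V - range c"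
  shows "links E x z \<le> 1"
proof (cases "low z")
  case False
  then show ?thesis using outside_not_low_links_le_1 x z by blast
next
  case True
  let ?O = "range c" and ?R = "V - range c"
  show ?thesis
  proof (rule ccontr)
    assume "\<not> ?thesis"
    then have two: "links E x z = 2" using links_le_2[of x z] by linarith
    have one: "links E x y = 1"
      using linked outside_not_low_links_le_1[OF x(1) y(1) x(2) y(2)] by linarith
    have "opposite x y" "opposite x z"
      using links_le_opposite[of x y] links_le_opposite[of x z] linked two by (auto split: if_splits simp: of_bool_def)
    then have sum: "3 * a \<le> deg y + deg z"
      using True y z by (intro degree_sum) auto
    have "deg_in E ?O x + deg_in E ?O y \<le> 3 * m"
      using pair_degree_bound[OF x(1) y(1)] one by simp
    moreover have "deg_in E ?O x + deg_in E ?O z \<le> 2 * m"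
      using pair_degree_bound[OF x(1) z] two by simp
    moreover have "deg_in E ?R x \<le> (a - m) + 1" "deg_in E ?R y \<le> (a - m) + 1"
      using outside_not_low_deg_le x y by blast+
    moreover have "deg_in E ?R z \<le> 2 * (a - m)" by (rule deg_in_le[OF even_cycle_complement])
    moreover have "deg v = deg_in E ?O v + deg_in E ?R v" for v
      by (rule deg_split[OF balanced_subset[OF even_cycle_balanced]])
    note this[of x] this[of y] this[of z]
    moreover have "3 * a \<le> 2 * deg x" using x(2) by (simp add: low_def)
    ultimately show False using sum long room by linarith
  qed
qed

text \<open>
  If the two were adjacent, each of them would have at most \<open>a - m\<close> arcs outside the cycle, and
  together they would have at most \<open>3 * m\<close> arcs to and from the cycle. With a degree sum of at least \<open>3a\<close>
  this contradicts \<open>m < a\<close>.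
\<close>
lemma outside_not_low_unlinked:
  assumes x: "x \<in> V - range c" "\<not> low x" and y: "y \<in> V - range c" "\<not> low y"
  shows "links E x y = 0"
proof (rule ccontr)
  assume linked: "links E x y \<noteq> 0"
  let ?O = "range c" and ?R = "V - range c"
  have small: "deg_in E ?R u \<le> a - m"
    if u: "u \<in> ?R" "\<not> low u" and v: "v \<in> ?R" "\<not> low v" "links E u v \<noteq> 0" for u v
  proof -
    have "links E u z \<le> 1 * of_bool (opposite u z) + 0 * of_bool (low z \<and> opposite u z)" if "z \<in> ?R" for z
      using outside_linked_links_le_1[OF u v that] links_le_opposite[of u z] by (simp add: of_bool_def split: if_splits)
    from outside_deg_le[OF u(1) this] show ?thesis by simp
  qed
  have "deg_in E ?R x \<le> a - m" using small[OF x y linked] .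
  moreover have "deg_in E ?R y \<le> a - m" using small[OF y x] linked by (simp add: links_commute)
  moreover have "deg_in E ?O x + deg_in E ?O y \<le> 3 * m"
  proof -
    have "m * 1 \<le> m * links E x y" using linked by (intro mult_le_mono2) simp
    then show ?thesis using pair_degree_bound[OF x(1) y(1)] by linarith
  qed
  moreover have "deg v = deg_in E ?O v + deg_in E ?R v" for v
    by (rule deg_split[OF balanced_subset[OF even_cycle_balanced]])
  note this[of x] this[of y]
  ultimately show False using x(2) y(2) long room unfolding low_def by linarith
qed

lemma outside_not_low_deg_le_2:
  assumes "x \<in> V - range c" "\<not> low x"
  shows "deg_in E (V - range c) x \<le> 2"
proof -
  have "links E x y \<le> 0 * of_bool (opposite x y) + 2 * of_bool (low y \<and> opposite x y)"
    if "y \<in> V - range c" for y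
    using outside_not_low_unlinked[OF assms that] links_le_opposite[of x y]
    by (cases "low y") (auto simp: of_bool_def split: if_splits)
  from outside_deg_le[OF assms(1) this] show ?thesis by simp
qed

end
end
end

text \<open>
  Choose outside vertices \<open>x \<in> X\<close> and \<open>y \<notin> X\<close> that are not low. By counting, \<open>x\<close> can replace some cycle vertex that
  is not low and is adjacent to \<open>y\<close>. On the new cycle this vertex and \<open>y\<close> violate
  \<open>outside_not_low_unlinked\<close>.
\<close>
lemma longer_cycle:
  assumes xs: "cycle_list E xs" "length xs = 2 * m" and long: "a < 2 * m" and room: "m + 2 \<le> a"
  obtains ys where "cycle_list E ys" "length ys = 2 * m + 2"
proof (rule ccontr)
  assume "\<not> thesis"
  then have no: "\<forall>ys. cycle_list E ys \<longrightarrow> length ys \<noteq> 2 * m + 2"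
    using that by blast
  obtain c where c: "cycle_fun E (2 * m) c"
    using cycle_list_imp_fun[OF xs(1)] xs(2) by metis
  let ?O = "range c" and ?R = "V - range c"
  have balO: "balanced m ?O" by (rule even_cycle_balanced[OF c])
  have balR: "balanced (a - m) ?R" by (rule even_cycle_complement[OF c])
  have side: "\<exists>v\<in>?R. (v \<in> X) = b \<and> \<not> low v" for b
  proof -
    let ?T = "{v \<in> ?R. (v \<in> X) = b}"
    have "?T \<subseteq> V" "2 \<le> card ?T" using card_side[OF balR, of b] room by auto
    then obtain v where "v \<in> ?T" "\<not> low v"
      by (rule exists_not_low[where b = b]) auto
    then show ?thesis by blast
  qed
  obtain x where x: "x \<in> ?R" "\<not> low x" "x \<in> X" using side[of True] by blast
  obtain y where y: "y \<in> ?R" "\<not> low y" "y \<notin> X" using side[of False] by blast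
  \<comment> \<open>The cycle vertex to be replaced by \<open>x\<close> is \<open>c (i + 1)\<close>.\<close>
  have swap: "\<exists>i. E (c i) x \<and> E x (c (i + 2)) \<and> \<not> low (c (i + 1)) \<and> links E (c (i + 1)) y \<noteq> 0"
  proof (rule ccontr)
    assume none: "\<not> ?thesis"
    \<comment> \<open>Shifts are chosen so that all three arc counts for an index \<open>i\<close> concern the replacement
      of \<open>c (i + 1)\<close>; each index contributes at most 4, or 6 if \<open>c (i + 1)\<close> is low.\<close>
    have "2 * deg_in E ?O x + deg_in E ?O y =
       2 * ((\<Sum>i<2 * m. of_bool (E x (c (i + 2)))) + (\<Sum>i<2 * m. of_bool (E (c (i + 0)) x))) +
       (\<Sum>i<2 * m. links E y (c (i + 1)))"
      unfolding deg_in_eq[of E ?O x] deg_in_def[of E ?O y]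
      by (intro arg_cong2[where f = "(+)"] arg_cong2[where f = "(*)"] refl cycle_fun_sum[OF c])
    also have "\<dots> = (\<Sum>i<2 * m. 2 * of_bool (E x (c (i + 2))) + 2 * of_bool (E (c i) x) + links E y (c (i + 1)))"
      by (simp add: sum.distrib sum_distrib_left algebra_simps del: sum_of_bool_eq)
    also have "\<dots> \<le> (\<Sum>i<2 * m. 4 * of_bool (opposite x (c (i + 0))) +
        2 * of_bool (low (c (i + 1)) \<and> (c (i + 1) \<in> X) = True))"
    proof (rule sum_mono)
      fix i
      show "2 * of_bool (E x (c (i + 2))) + 2 * of_bool (E (c i) x) + links E y (c (i + 1)) \<le>
        4 * of_bool (opposite x (c (i + 0))) + 2 * of_bool (low (c (i + 1)) \<and> (c (i + 1) \<in> X) = True)"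
      proof (cases "c i \<in> X")
        case True
        then have "c (i + 2) \<in> X" "c (i + 1) \<notin> X"
          using cycle_fun_opposite[OF c, of i 1] cycle_fun_opposite[OF c, of i 2] by auto
        then show ?thesis
          using True links_le_opposite[of y "c (i + 1)"] edgeD[of x "c (i + 2)"] edgeD[of "c i" x] x(3) y(3)
          by auto
      next
        case False
        then have up: "c (i + 1) \<in> X" using cycle_fun_opposite[OF c, of i 1] by simp
        have le: "links E y (c (i + 1)) \<le> 2" by (rule links_le_2)
        have "\<not> (E (c i) x \<and> E x (c (i + 2))) \<or> low (c (i + 1)) \<or> links E y (c (i + 1)) = 0"
          using none links_commute[of E y "c (i + 1)"] by auto
        then have "2 * of_bool (E x (c (i + 2))) + 2 * of_bool (E (c i) x) + links E y (c (i + 1)) \<le>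
          4 + 2 * of_bool (low (c (i + 1)))"
          using le by (auto simp: of_bool_def)
        then show ?thesis using False up x(3) by simp
      qed
    qed
    also have "\<dots> = 4 * (\<Sum>i<2 * m. of_bool (opposite x (c (i + 0)))) +
        2 * (\<Sum>i<2 * m. of_bool (low (c (i + 1)) \<and> (c (i + 1) \<in> X) = True))"
      by (simp add: sum.distrib sum_distrib_left del: sum_of_bool_eq)
    also have "(\<Sum>i<2 * m. of_bool (opposite x (c (i + 0))) :: nat) = (\<Sum>v\<in>?O. of_bool (opposite x v))"
      by (rule cycle_fun_sum[OF c, symmetric])
    also have "(\<Sum>v\<in>?O. of_bool (opposite x v)) = m" by (rule sum_opposite(1)[OF balO])
    also have "(\<Sum>i<2 * m. of_bool (low (c (i + 1)) \<and> (c (i + 1) \<in> X) = True) :: nat) =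
        (\<Sum>v\<in>?O. of_bool (low v \<and> (v \<in> X) = True))"
      by (rule cycle_fun_sum[OF c, symmetric])
    finally have "2 * deg_in E ?O x + deg_in E ?O y \<le> 4 * m + 2"
      using sum_low_le_1[OF balanced_subset[OF balO], of True] by (simp del: sum_of_bool_eq)
    moreover have "deg_in E ?R x \<le> 2" "deg_in E ?R y \<le> 2"
      using outside_not_low_deg_le_2[OF c no long room] x y by blast+
    moreover have "deg v = deg_in E ?O v + deg_in E ?R v" for v
      by (rule deg_split[OF balanced_subset[OF balO]])
    note this[of x] this[of y]
    ultimately show False using x(2) y(2) room long unfolding low_def by linarith
  qed
  then obtain i where i: "E (c i) x" "E x (c (i + 2))" "\<not> low (c (i + 1))" "links E (c (i + 1)) y \<noteq> 0"
    by blast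
  let ?zs = "map c [i + 2..<i + 2 + (2 * m - 1)] @ [x]"
  have m: "m \<ge> 2" using long room by linarith
  have "i + 2 + (2 * m - 1) - 1 = i + 2 * m" using m by linarith
  then have zs: "cycle_list E ?zs"
    using i x m by (intro cycle_fun_splice[OF c]) (auto simp: cycle_fun_add_period[OF c])
  have "length ?zs = 2 * m" using m by (simp del: upt_Suc)
  then obtain d where d: "cycle_fun E (2 * m) d" "range d = set ?zs"
    using cycle_list_imp_fun[OF zs] by metis
  have "c (i + 1) \<notin> c ` {i + 2..<i + 2 + (2 * m - 1)}"
    using cycle_fun_inj_on_window[OF c, of "2 * m" "i + 1"] m by (auto dest: inj_onD)
  then have "c (i + 1) \<in> V - range d"
    using x cycle_fun_in_V[OF c] by (auto simp: d(2))
  moreover have "y \<in> V - range d"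
    using y x by (auto simp: d(2))
  ultimately show False
    using outside_not_low_unlinked[OF d(1) no long room, of "c (i + 1)" y] i(3,4) y(2) by simp
qed

section \<open>A long cycle that is not Hamiltonian\<close>

text \<open>
  In general there are at least 24 arcs for \<open>a = 4\<close>. A low vertex improves the
  degree sum on its side by 2, because each of the three other vertices must make up for
  its deficit.
\<close>
lemma low_pair_arcs:
  assumes "a = 4" and p: "p \<in> V" "low p" and q: "q \<in> V" "low q" and "opposite p q"
  shows "26 \<le> (\<Sum>v\<in>V. \<Sum>w\<in>V. of_bool (E v w) :: nat)"
proof -
  have side: "26 \<le> (\<Sum>v\<in>{v \<in> V. (v \<in> X) = (u \<in> X)}. deg v)" if u: "u \<in> V" "low u" for u
  proof -
    let ?T = "{v \<in> V. (v \<in> X) = (u \<in> X)}"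
    have fin: "finite ?T" using finite_V by simp
    have "card (?T - {u}) = 3"
      using card_side[OF balanced_V, of "u \<in> X"] u(1) assms(1) fin by simp
    moreover have "(\<Sum>v\<in>?T - {u}. 12 - deg u) \<le> (\<Sum>v\<in>?T - {u}. deg v)"
    proof (rule sum_mono)
      fix v assume "v \<in> ?T - {u}"
      then show "12 - deg u \<le> deg v" using degree_sum[of u v] u(1) assms(1) by auto
    qed
    moreover have "(\<Sum>v\<in>?T. deg v) = deg u + (\<Sum>v\<in>?T - {u}. deg v)"
      using fin u(1) by (intro sum.remove) auto
    moreover have "deg u \<le> 5" using u(2) assms(1) unfolding low_def by simp
    ultimately show ?thesis by simp
  qed
  have "(\<Sum>v\<in>V. deg v) = (\<Sum>v\<in>{v \<in> V. (v \<in> X) = (p \<in> X)} \<union> {v \<in> V. (v \<in> X) = (q \<in> X)}. deg v)"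
    using assms(6) by (intro sum.cong) auto
  also have "\<dots> = (\<Sum>v\<in>{v \<in> V. (v \<in> X) = (p \<in> X)}. deg v) + (\<Sum>v\<in>{v \<in> V. (v \<in> X) = (q \<in> X)}. deg v)"
    using assms(6) finite_V by (intro sum.union_disjoint) auto
  finally show ?thesis
    using side[OF p] side[OF q] sum_deg_in_self[of E V] by linarith
qed

text \<open>
  These are the distances, measured along a Hamiltonian cycle, over which an arc may run if
  there are no chords of distance between 2 and \<open>a\<close>.
\<close>
lemma card_long_distances:
  "card {d. d < 2 * a \<and> odd d \<and> (d = 1 \<or> a < d)} \<le> a div 2 + 1"
proof -
  have "{d. d < 2 * a \<and> odd d \<and> (d = 1 \<or> a < d)} \<subseteq> insert 1 ((\<lambda>j. 2 * a - 1 - 2 * j) ` {..<a div 2})"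
  proof
    fix d assume d: "d \<in> {d. d < 2 * a \<and> odd d \<and> (d = 1 \<or> a < d)}"
    show "d \<in> insert 1 ((\<lambda>j. 2 * a - 1 - 2 * j) ` {..<a div 2})"
    proof (cases "d = 1")
      case False
      then have d': "d < 2 * a" "odd d" "a < d" using d by auto
      obtain e where e: "d = 2 * e + 1" using d'(2) by (rule oddE)
      have "d = 2 * a - 1 - 2 * (a - 1 - e)" "a - 1 - e < a div 2" using d' e by linarith+
      then show ?thesis by blast
    qed simp
  qed
  then have "card {d. d < 2 * a \<and> odd d \<and> (d = 1 \<or> a < d)} \<le> card (insert 1 ((\<lambda>j. 2 * a - 1 - 2 * j) ` {..<a div 2}))"
    by (intro card_mono) auto
  also have "\<dots> \<le> Suc (card ((\<lambda>j. 2 * a - 1 - 2 * j) ` {..<a div 2}))"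
    by (simp add: card_insert_if)
  also have "\<dots> \<le> Suc (card {..<a div 2})"
    using card_image_le[of "{..<a div 2}"] by simp
  finally show ?thesis by simp
qed

text \<open>
  If there is no such cycle, then every chord of distance \<open>3 \<le> d \<le> a\<close> on a Hamiltonian cycle \<open>c\<close> skips low vertices
  only. As there are at most two low vertices, on opposite sides, this leaves \<open>d = 3\<close> and at
  most one such chord. Then there are at most \<open>2a(\<lfloor>a/2\<rfloor> + 1) + 1\<close> arcs, while the
  degree condition provides \<open>3a\<^sup>2/2\<close>; this is contradictory unless \<open>a = 4\<close>. In that case there is no
  chord of distance 3 at all, every chord of distance 5 or 7 is present, and
  \<open>c 0, c 5, c 4, c 3, c 2, c 7\<close> is a cycle of length 6.
\<close>
lemma exists_long_cycle_missing_not_low: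
  obtains ys v where "cycle_list E ys" "a < length ys" "length ys < 2 * a" "v \<in> V - set ys" "\<not> low v"
proof (rule ccontr)
  note conclusion = that
  assume "\<not> thesis"
  then have all_low: "low v"
    if "cycle_list E ys" "a < length ys" "length ys < 2 * a" "v \<in> V" "v \<notin> set ys" for ys v
    using that conclusion by blast
  obtain xs where xs: "cycle_list E xs" "length xs = 2 * a" by (rule hamiltonian)
  obtain c where c: "cycle_fun E (2 * a) c" and cx: "range c = set xs"
    using cycle_list_imp_fun[OF xs(1)] xs(2) by metis
  note c_eq = cycle_fun_eq_iff[OF c]
  have cV: "range c = V"
    using cycle_fun_card[OF c] cycle_fun_in_V[OF c] balanced_card[OF balanced_V] finite_V
    by (intro card_subset_eq) auto
  have window: "c (i + p) \<noteq> c (i + q)" if "p < q" "q < p + 2 * a" for i p q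
    using cycle_fun_inj_on_window[OF c, of "2 * a" "i + p"] that by (auto dest: inj_onD)
  have skipped: "low (c (i + j))"
    if "E (c i) (c (i + d))" "3 \<le> d" "d \<le> a" "1 \<le> j" "j < d" for i d j
  proof -
    \<comment> \<open>The chord bypasses \<open>c (i + 1), \<dots>, c (i + d - 1)\<close>.\<close>
    let ?k = "2 * a + 1 - d"
    have "i + d + ?k - 1 = i + 2 * a" using that by linarith
    then have "cycle_list E (map c [i + d..<i + d + ?k])"
      using that a_ge_3 by (intro cycle_fun_close[OF c]) (auto simp: cycle_fun_add_period[OF c])
    moreover have "c (i + j) \<notin> set (map c [i + d..<i + d + ?k])"
    proof
      assume "c (i + j) \<in> set (map c [i + d..<i + d + ?k])"
      then obtain q where q: "i + d \<le> q" "q < i + d + ?k" "c q = c (i + j)" by auto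
      then have "j < q - i" "q - i < j + 2 * a" "i + (q - i) = q"
        using that by linarith+
      then show False using window[of j "q - i" i] q(3) by simp
    qed
    ultimately show ?thesis
      using that cycle_fun_in_V[OF c] by (intro all_low[of "map c [i + d..<i + d + ?k]"]) auto
  qed
  have only3: "d = 3" if "E (c i) (c (i + d))" "3 \<le> d" "d \<le> a" for i d
  proof (rule ccontr)
    \<comment> \<open>Being odd, \<open>d\<close> would be at least 5, and two vertices on the same side would be skipped.\<close>
    assume "d \<noteq> 3"
    then have "low (c (i + 1))" "low (c (i + 3))" using skipped[OF that, of 1] skipped[OF that, of 3] that by auto
    then have "c (i + 1) = c (i + 3)"
      using cycle_fun_in_V[OF c] cycle_fun_opposite[OF c, of i 1] cycle_fun_opposite[OF c, of i 3]
      by (intro low_unique) auto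
    then show False using window[of 1 3 i] a_ge_3 by simp
  qed
  define L where "L = {i. i < 2 * a \<and> E (c i) (c (i + 3))}"
  have lowL: "low (c (i + 1))" "low (c (i + 2))" if "i \<in> L" for i
    using skipped[of i 3 1] skipped[of i 3 2] that a_ge_3 by (auto simp: L_def)
  have finL: "finite L" by (simp add: L_def)
  \<comment> \<open>A chord of distance 3 skips exactly the two low vertices, and their order on the cycle
    is fixed because its length exceeds 2.\<close>
  have "card L \<le> Suc 0"
    unfolding card_le_Suc0_iff_eq[OF finL]
  proof (intro ballI, rule ccontr)
    fix i j assume ij: "i \<in> L" "j \<in> L" "i \<noteq> j"
    have ne: "c (i + 1) \<noteq> c (j + 1)"
      using ij cycle_fun_inj_on_window[OF c, of "2 * a" 1] by (auto simp: L_def dest!: inj_onD)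
    have same: "c p = c q" if "low (c p)" "low (c q)" "(c p \<in> X) = (c q \<in> X)" for p q
      using low_unique that cycle_fun_in_V[OF c] by blast
    have "opposite (c (i + 1)) (c (j + 1))" using same[of "i + 1" "j + 1"] ne lowL ij by blast
    then have "c (i + 2) = c (j + 1)" "c (i + 1) = c (j + 2)"
      using cycle_fun_opposite[OF c, of "i + 1" 1] cycle_fun_opposite[OF c, of "j + 1" 1] lowL ij
      by (auto intro!: same simp: add.assoc)
    then have "c (Suc (i + 2)) = c (i + 1)"
      using c_eq mod_Suc_eq[of "i + 2" "2 * a"] mod_Suc_eq[of "j + 1" "2 * a"] by simp
    then show False using window[of 1 3 i] a_ge_3 by (simp add: numeral_3_eq_3)
  qed
  then have cL: "card L \<le> 1" by simp
  define D where "D = {d. d < 2 * a \<and> odd d \<and> (d = 1 \<or> a < d)}"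
  define out where "out i = (\<Sum>w\<in>V. of_bool (E (c i) w) :: nat)" for i
  have out_eq: "out i = (\<Sum>d<2 * a. of_bool (E (c i) (c (d + i))))" for i
    unfolding out_def cV[symmetric] by (rule cycle_fun_sum[OF c])
  have short: "d \<in> D \<or> d = 3" if "E (c i) (c (d + i))" "d < 2 * a" for i d
  proof -
    have "odd d" using edgeD[OF that(1)] cycle_fun_opposite[OF c, of i d] by (auto simp: add.commute)
    then have "d = 1 \<or> 3 \<le> d" by presburger
    then show ?thesis
      using only3[of i d] that \<open>odd d\<close> by (cases "d \<le> a") (auto simp: D_def add.commute)
  qed
  have sumD: "(\<Sum>d<2 * a. of_bool (d \<in> D)) \<le> a div 2 + 1"
  proof -
    have "{..<2 * a} \<inter> D = D" by (auto simp: D_def)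
    moreover have "card D \<le> a div 2 + 1" unfolding D_def by (rule card_long_distances)
    ultimately show ?thesis by simp
  qed
  have out_le: "out i \<le> a div 2 + 1 + of_bool (i \<in> L)" if "i < 2 * a" for i
  proof -
    have "out i \<le> (\<Sum>d<2 * a. of_bool (d \<in> D) + of_bool (d = 3 \<and> i \<in> L))"
      unfolding out_eq
    proof (rule sum_mono)
      fix d assume "d \<in> {..<2 * a}"
      then show "of_bool (E (c i) (c (d + i))) \<le> (of_bool (d \<in> D) + of_bool (d = 3 \<and> i \<in> L) :: nat)"
        using short[of i d] that by (auto simp: L_def add.commute[of i 3])
    qed
    also have "\<dots> = (\<Sum>d<2 * a. of_bool (d \<in> D)) + (\<Sum>d<2 * a. of_bool (d = 3 \<and> i \<in> L))"
      by (rule sum.distrib)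
    also have "(\<Sum>d<2 * a. of_bool (d = 3 \<and> i \<in> L)) \<le> (of_bool (i \<in> L) :: nat)"
      using card_mono[of "{3}" "{..<2 * a} \<inter> {3}"] by (cases "i \<in> L") auto
    finally show ?thesis using sumD by linarith
  qed
  define arcs where "arcs = (\<Sum>i<2 * a. out i)"
  have arcs_eq: "arcs = (\<Sum>v\<in>V. \<Sum>w\<in>V. of_bool (E v w))"
    unfolding arcs_def out_def cV[symmetric] using cycle_fun_sum[OF c, of "\<lambda>v. \<Sum>w\<in>range c. of_bool (E v w) :: nat" 0]
    by simp
  have "3 * a * a \<le> (\<Sum>v\<in>V. deg v)"
    using a_ge_3 by (intro sum_degrees_balanced[OF balanced_V]) simp
  then have many: "3 * a * a \<le> 2 * arcs"
    by (simp only: sum_deg_in_self arcs_eq)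
  have "arcs \<le> (\<Sum>i<2 * a. a div 2 + 1 + of_bool (i \<in> L))"
    unfolding arcs_def by (rule sum_mono) (use out_le in auto)
  also have "\<dots> = 2 * a * (a div 2 + 1) + card L"
  proof -
    have "{..<2 * a} \<inter> L = L" by (auto simp: L_def)
    then have "(\<Sum>i<2 * a. of_bool (i \<in> L)) = card L" by simp
    then show ?thesis by (subst sum.distrib) simp
  qed
  finally have few: "arcs \<le> 2 * a * (a div 2 + 1) + card L" .
  have a4: "a = 4"
  proof (rule ccontr)
    assume "a \<noteq> 4"
    then consider "a = 3" | "a \<ge> 5" using a_ge_3 by linarith
    then show False
    proof cases
      case 1
      then show ?thesis using many few cL by simp
    next
      case 2
      have "a * (2 * (a div 2)) \<le> a * a" by (rule mult_le_mono2) simp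
      then have "2 * (a * (a div 2)) \<le> a * a" by (simp only: mult.left_commute)
      moreover have "arcs \<le> 2 * (a * (a div 2)) + 2 * a + 1"
        using few cL by (simp add: algebra_simps)
      moreover have "3 * (a * a) \<le> 2 * arcs" using many by (simp only: mult.assoc)
      ultimately have "a * a \<le> 4 * a + 2" by linarith
      moreover have "5 * a \<le> a * a" using 2 by simp
      ultimately show ?thesis using 2 by linarith
    qed
  qed
  have no_low_pair: "\<not> (low (c p) \<and> low (c q))" if "opposite (c p) (c q)" for p q
    using low_pair_arcs[OF a4, of "c p" "c q"] cycle_fun_in_V[OF c] that few cL a4 arcs_eq by auto
  have L_empty: "L = {}"
    using no_low_pair[of "i + 1" "i + 2" for i] lowL cycle_fun_opposite[OF c, of "i + 1" 1 for i]
    by (fastforce simp: numeral_2_eq_2)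
  have chord: "E (c i) (c (i + d))" if "i < 8" "d \<in> {5, 7}" for i d
  proof (rule ccontr)
    assume miss: "\<not> E (c i) (c (i + d))"
    have dD: "d \<in> D" "d < 2 * a" using that a4 by (auto simp: D_def)
    have "out i < (\<Sum>d<2 * a. of_bool (d \<in> D))"
      unfolding out_eq
    proof (rule sum_strict_mono_ex1)
      show "\<forall>e\<in>{..<2 * a}. of_bool (E (c i) (c (e + i))) \<le> (of_bool (e \<in> D) :: nat)"
      proof
        fix e assume "e \<in> {..<2 * a}"
        then show "of_bool (E (c i) (c (e + i))) \<le> (of_bool (e \<in> D) :: nat)"
          using short[of i e] L_empty that a4 by (auto simp: L_def add.commute[of i 3])
      qed
      show "\<exists>e\<in>{..<2 * a}. of_bool (E (c i) (c (e + i))) < (of_bool (e \<in> D) :: nat)"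
        using miss dD by (intro bexI[of _ d]) (auto simp: add.commute[of d i])
    qed simp
    then have "out i < 3" using sumD a4 by simp
    then have "arcs < (\<Sum>i<2 * a. 3)"
      unfolding arcs_def using out_le L_empty that a4 by (intro sum_strict_mono_ex1) auto
    then show False using many a4 by simp
  qed
  have step: "E (c i) (c j)" if "i < 8" "d \<in> {5, 7}" "(i + d) mod 8 = j" for i d j
    using chord[OF that(1,2)] c_eq[of "i + d" j] that a4 by auto
  have "E (c 7) (c 0)"
    using cycle_fun_step[OF c, of 7] c_eq[of 8 0] a4 by simp
  then have "cycle_list E [c 0, c 5, c 4, c 3, c 2, c 7]"
    using step[of 0 5 5] step[of 5 7 4] step[of 4 7 3] step[of 3 7 2] step[of 2 5 7] a4
    by (simp add: cycle_list_def c_eq)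
  from all_low[OF this] have "low (c 1)" "low (c 6)"
    using a4 cycle_fun_in_V[OF c] by (auto simp: c_eq)
  then show False
    using no_low_pair[of 1 6] cycle_fun_opposite[OF c, of 1 5] by simp
qed

section \<open>All even lengths\<close>

theorem even_pancyclic:
  assumes k: "1 \<le> k" "k \<le> a"
  obtains ys where "cycle_list E ys" "length ys = 2 * k"
proof -
  obtain xs v where xs: "cycle_list E xs" "a < length xs" "length xs < 2 * a" "v \<in> V - set xs" "\<not> low v"
    by (rule exists_long_cycle_missing_not_low)
  obtain m where m: "length xs = 2 * m"
    using cycle_list_balanced(1)[OF xs(1)] by blast
  obtain c where c: "cycle_fun E (2 * m) c" "range c = set xs"
    using cycle_list_imp_fun[OF xs(1)] m by metis
  have longer: "\<exists>ys. cycle_list E ys \<and> length ys = 2 * l" if "m \<le> l" "l < a" for l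
    using that
  proof (induction l rule: dec_induct)
    case base
    then show ?case using xs(1) m by blast
  next
    case (step l)
    then obtain ys where "cycle_list E ys" "length ys = 2 * l" by auto
    then obtain zs where "cycle_list E zs" "length zs = 2 * l + 2"
      by (rule longer_cycle) (use step xs m in auto)
    then show ?case by (intro exI[of _ zs]) simp
  qed
  consider "k \<le> m" | "m \<le> k" "k < a" | "k = a" using k by linarith
  then have "\<exists>ys. cycle_list E ys \<and> length ys = 2 * k"
  proof cases
    case 1
    obtain ys where "cycle_list E ys" "length ys = 2 * k"
      by (rule long_cycle_shorter[OF c(1) _ _ xs(5) k(1) 1]) (use xs c m in auto)
    then show ?thesis by blast
  next
    case 2
    then show ?thesis by (rule longer)
  next
    case 3
    then show ?thesis using hamiltonian by metis
  qed
  then show ?thesis using that by blast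
qed

end

section \<open>Transfer to digraphs with explicit arcs\<close>

lemma (in wf_digraph) successively_imp_awalk:
  assumes "successively (\<lambda>u v. u \<rightarrow>\<^bsub>G\<^esub> v) (u # vs)" "u \<in> verts G"
  shows "\<exists>p. awalk u p (last (u # vs)) \<and> awalk_verts u p = u # vs"
  using assms
proof (induction vs arbitrary: u)
  case Nil
  then have "awalk u [] (last [u]) \<and> awalk_verts u [] = [u]" by (simp add: awalk_Nil_iff)
  then show ?case by blast
next
  case (Cons v vs)
  then obtain e where e: "e \<in> arcs G" "tail G e = u" "head G e = v"
    by (auto simp: arcs_ends_conv)
  have "successively (\<lambda>u v. u \<rightarrow>\<^bsub>G\<^esub> v) (v # vs)" "v \<in> verts G"
    using Cons.prems e by auto
  then obtain p where "awalk v p (last (v # vs))" "awalk_verts v p = v # vs"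
    using Cons.IH by blast
  then have "awalk u (e # p) (last (u # v # vs)) \<and> awalk_verts u (e # p) = u # v # vs"
    using e by (simp add: awalk_Cons_iff)
  then show ?case by blast
qed

lemma (in wf_digraph) cycle_list_imp_has_cycle:
  assumes "cycle_list (\<lambda>u v. u \<rightarrow>\<^bsub>G\<^esub> v) xs"
  shows "has_cycle_of_length G (length xs)"
proof -
  obtain u vs where xs: "xs = u # vs"
    using assms by (cases xs) (auto simp: cycle_list_def)
  have "successively (\<lambda>u v. u \<rightarrow>\<^bsub>G\<^esub> v) (u # (vs @ [u]))"
    using assms successively_append_iff[of "\<lambda>u v. u \<rightarrow>\<^bsub>G\<^esub> v" xs "[u]"] by (simp add: cycle_list_def xs)
  moreover have "u \<in> verts G"
    using assms by (auto simp: cycle_list_def xs adj_in_verts)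
  ultimately obtain p where p: "awalk u p (last (u # (vs @ [u])))" "awalk_verts u p = u # (vs @ [u])"
    using successively_imp_awalk by blast
  have len: "length p = length xs"
    using length_awalk_verts[of u p] p(2) by (simp add: xs)
  have "pre_digraph.cycle G p"
    unfolding cycle_def
  proof (intro exI conjI)
    show "awalk u p u" using p(1) by simp
    show "distinct (tl (awalk_verts u p))"
      using assms p(2) by (simp add: cycle_list_def xs)
    show "p \<noteq> []" using len by (auto simp: xs)
  qed
  then show ?thesis using len by (auto simp: has_cycle_of_length_def)
qed

lemma (in nomulti_digraph) out_degree_eq_card: "out_degree G v = card {w. v \<rightarrow>\<^bsub>G\<^esub> w}"
proof -
  have "inj_on (head G) (out_arcs G v)"
    using no_multi_arcs by (auto simp: inj_on_def arc_to_ends_def)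
  moreover have "head G ` out_arcs G v = {w. v \<rightarrow>\<^bsub>G\<^esub> w}"
    by (auto simp: arcs_ends_conv)
  ultimately show ?thesis unfolding out_degree_def by (metis card_image)
qed

lemma (in nomulti_digraph) in_degree_eq_card: "in_degree G v = card {w. w \<rightarrow>\<^bsub>G\<^esub> v}"
proof -
  have "inj_on (tail G) (in_arcs G v)"
    using no_multi_arcs by (auto simp: inj_on_def arc_to_ends_def)
  moreover have "tail G ` in_arcs G v = {w. w \<rightarrow>\<^bsub>G\<^esub> v}"
    by (auto simp: arcs_ends_conv)
  ultimately show ?thesis unfolding in_degree_def by (metis card_image)
qed

lemma (in digraph) degree_eq_deg_in:
  "degree G v = deg_in (\<lambda>u v. u \<rightarrow>\<^bsub>G\<^esub> v) (verts G) v"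
proof -
  have "verts G \<inter> {w. v \<rightarrow>\<^bsub>G\<^esub> w} = {w. v \<rightarrow>\<^bsub>G\<^esub> w}" "verts G \<inter> {w. w \<rightarrow>\<^bsub>G\<^esub> v} = {w. w \<rightarrow>\<^bsub>G\<^esub> v}"
    by (auto simp: adj_in_verts)
  then show ?thesis
    by (simp add: degree_def deg_in_eq out_degree_eq_card in_degree_eq_card)
qed

lemma (in wf_digraph) strongly_connected_leaving_arc:
  assumes "strongly_connected G" "S \<subseteq> verts G" "S \<noteq> {}" "S \<noteq> verts G"
  shows "\<exists>u\<in>S. \<exists>v\<in>verts G - S. u \<rightarrow>\<^bsub>G\<^esub> v"
proof (rule ccontr)
  assume none: "\<not> ?thesis"
  obtain u v where uv: "u \<in> S" "v \<in> verts G" "v \<notin> S" using assms by blast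
  then have "u \<rightarrow>\<^sup>* v" using assms by (auto simp: strongly_connected_def)
  then have "v \<in> S"
    by (induction rule: reachable_induct) (use uv none adj_in_verts in blast)+
  then show False using uv by blast
qed

theorem theorem1p14:
  fixes D :: "('a, 'b) pre_digraph" and X Y :: "'a set" and a :: nat
  assumes "digraph D"
    and "strongly_connected D"
    and "balanced_bipartite_digraph D X Y"
    and "card (verts D) = 2 * a"
    and "2 * a \<ge> 6"
    and "\<And>x y. x \<noteq> y \<Longrightarrow> (x \<in> X \<and> y \<in> X) \<or> (x \<in> Y \<and> y \<in> Y) \<Longrightarrow>
           degree D x + degree D y \<ge> 3 * a"
  shows "\<forall>m. even m \<and> 2 \<le> m \<and> m \<le> 2 * a \<longrightarrow> has_cycle_of_length D m"
proof (intro allI impI)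
  interpret digraph D by fact
  have parts: "verts D = X \<union> Y" "X \<inter> Y = {}" "card X = card Y"
    and arcs: "\<And>e. e \<in> arcs D \<Longrightarrow> (tail D e \<in> X \<and> head D e \<in> Y) \<or> (tail D e \<in> Y \<and> head D e \<in> X)"
    using assms(3) by (auto simp: balanced_bipartite_digraph_def bipartite_digraph_def)
  have Y: "verts D - X = Y" using parts by blast
  have "card (verts D) = card X + card Y"
    using parts finite_verts by (simp add: card_Un_disjoint)
  then have card: "card X = a" "card Y = a" using parts(3) assms(4) by simp_all
  interpret dense_bipartite "verts D" X "\<lambda>u v. u \<rightarrow>\<^bsub>D\<^esub> v" a
  proof
    show "u \<in> verts D \<and> v \<in> verts D \<and> (u \<in> X) \<noteq> (v \<in> X)" if "u \<rightarrow>\<^bsub>D\<^esub> v" for u v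
      using that arcs parts(1,2) by (fastforce simp: arcs_ends_conv)
    show "3 * a \<le> deg_in (\<lambda>u v. u \<rightarrow>\<^bsub>D\<^esub> v) (verts D) u + deg_in (\<lambda>u v. u \<rightarrow>\<^bsub>D\<^esub> v) (verts D) v"
      if "u \<in> verts D" "v \<in> verts D" "u \<noteq> v" "(u \<in> X) = (v \<in> X)" for u v
      using assms(6)[of u v] that parts(1) by (auto simp: degree_eq_deg_in)
    show "\<exists>u\<in>S. \<exists>v\<in>verts D - S. u \<rightarrow>\<^bsub>D\<^esub> v"
      if "S \<subseteq> verts D" "S \<noteq> {}" "S \<noteq> verts D" for S
      using strongly_connected_leaving_arc[OF assms(2) that] .
  qed (use parts card Y assms(5) in auto)
  fix m assume m: "even m \<and> 2 \<le> m \<and> m \<le> 2 * a"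
  then obtain k where k: "m = 2 * k" by blast
  obtain xs where "cycle_list (\<lambda>u v. u \<rightarrow>\<^bsub>D\<^esub> v) xs" "length xs = 2 * k"
    using even_pancyclic[of k] m k by auto
  then show "has_cycle_of_length D m"
    using cycle_list_imp_has_cycle k by metis
qed

end
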